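(* Let $\mathcal{M}$ be a Poisson manifold whose Poisson bivector is invertible, $\pi=\omega^{-1}$ with $\omega$ a symplectic $2$-form, and let $\mathcal{D}$ be a flat, torsion-free contravariant connection on $\mathcal{M}$ with metacurvature $M$. Let $\nabla$ be the flat, torsion-free (covariant) connection defined by $\#\mathcal{D}_\alpha\beta=\nabla_{\#\alpha}\#\beta$. Then $$M^{ijk}_{lm}=\mathcal{D}^i\mathcal{D}^j\mathcal{D}^k\omega_{lm}$$ and $$M^{ijk}_{lm}=-\pi^{ia}\pi^{jb}\pi^{kc}\,\omega_{dl}\,\omega_{em}\,\pi^{de}{}_{|abc},$$ where the vertical bar denotes covariant derivatives with respect to $\nabla$.
   Context: Summation over repeated indices is implicit. The Poisson bracket is $\{f,g\}=\pi^{ij}\partial_if\,\partial_jg$, and $\pi=\omega^{-1}$ means $\pi^{ij}\omega_{jk}=\delta^i_k$. The anchor is $(\#\alpha)^i=\pi^{ji}\alpha_j$. The Koszul bracket $[\cdot,\cdot]_\pi$ on $\Omega^1(\mathcal{M})$ is the unique Lie bracket with $[\alpha,f\beta]_\pi=f[\alpha,\beta]_\pi+(\#\alpha)(f)\beta$ and $[df,dg]_\pi=d\{f,g\}$. A contravariant connection is a bilinear map $(\alpha,\beta)\mapsto\mathcal{D}_\alpha\beta$ on $\Omega^1(\mathcal{M})$ with $\mathcal{D}_{f\alpha}\beta=f\mathcal{D}_\alpha\beta$ and $\mathcal{D}_\alpha(f\beta)=f\mathcal{D}_\alpha\beta+(\#\alpha)(f)\beta$; it is flat if $\mathcal{D}_\alpha\mathcal{D}_\beta-\mathcal{D}_\beta\mathcal{D}_\alpha-\mathcal{D}_{[\alpha,\beta]_\pi}=0$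 and torsion-free if $\mathcal{D}_\alpha\beta-\mathcal{D}_\beta\alpha=[\alpha,\beta]_\pi$. It extends to tensors by the Leibniz rule, with $\mathcal{D}_\alpha f=(\#\alpha)(f)$; $\mathcal{D}^i$ denotes its index form, $\mathcal{D}_\alpha=\alpha_i\mathcal{D}^i$. Metacurvature: given a flat torsion-free $\mathcal{D}$, put $\{f,\sigma\}:=\mathcal{D}_{df}\sigma$ for functions $f$ and forms $\sigma$, and let $\{\alpha,\beta\}\in\Omega^2(\mathcal{M})$, for $1$-forms $\alpha,\beta$, be the unique symmetric bilinear bracket with $\{f\alpha,\beta\}=f\{\alpha,\beta\}+\alpha\wedge\{f,\beta\}$ and $d\{f,\beta\}=\{df,\beta\}+\{f,d\beta\}$. The metacurvature is the tensor $M^{ijk}_{lm}$, symmetric in $ijk$ and antisymmetric in $lm$, with $M(\alpha,\beta,\gamma)_{lm}=M^{ijk}_{lm}\alpha_i\beta_j\gamma_k$ and $M(df,\beta,\gamma)=\{f,\{\beta,\gamma\}\}-\{\{f,\beta\},\gamma\}-\{\{f,\gamma\},\beta\}$. *)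

theory Defs
  imports "HOL-Analysis.Analysis" "HOL-Library.Function_Algebras"
begin

section \<open>Smooth manifolds\<close>

primrec Ck_on :: "nat \<Rightarrow> 'a::real_normed_vector set \<Rightarrow> ('a \<Rightarrow> 'b::real_normed_vector) \<Rightarrow> bool" where
  "Ck_on 0 S f \<longleftrightarrow> continuous_on S f"
| "Ck_on (Suc n) S f \<longleftrightarrow>
     (\<forall>x\<in>S. f differentiable (at x)) \<and> (\<forall>v. Ck_on n S (\<lambda>x. frechet_derivative f (at x) v))"

text \<open>Used only for open \<open>S\<close> in a finite-dimensional space, where it says that all iterated
  directional derivatives exist and are continuous.\<close>

definition smooth_on :: "'a::real_normed_vector set \<Rightarrow> ('a \<Rightarrow> 'b::real_normed_vector) \<Rightarrow> bool" where
  "smooth_on S f \<longleftrightarrow> (\<forall>n. Ck_on n S f)"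

text \<open>The manifold is the whole type \<open>'m\<close>; a chart is a pair of its domain and the coordinate
  map, whose values outside the domain are irrelevant. The atlas need not be maximal.\<close>

type_synonym ('m, 'e) chart = "'m set \<times> ('m \<Rightarrow> 'e)"

definition smooth_atlas ::
  "('m::{t2_space,second_countable_topology}, 'e::euclidean_space) chart set \<Rightarrow> bool" where
  "smooth_atlas A \<longleftrightarrow>
     (\<Union>(U, \<phi>)\<in>A. U) = UNIV \<and>
     (\<forall>(U, \<phi>)\<in>A. open U \<and> open (\<phi> ` U) \<and> homeomorphism U (\<phi> ` U) \<phi> (inv_into U \<phi>)) \<and>
     (\<forall>(U, \<phi>)\<in>A. \<forall>(V, \<psi>)\<in>A. smooth_on (\<phi> ` (U \<inter> V)) (\<psi> \<circ> inv_into U \<phi>))"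

definition Cinf :: "('m, 'e::euclidean_space) chart set \<Rightarrow> ('m \<Rightarrow> real) set" where
  "Cinf A = {f. \<forall>(U, \<phi>)\<in>A. smooth_on (\<phi> ` U) (f \<circ> inv_into U \<phi>)}"

section \<open>Vector fields, forms and tensors\<close>

text \<open>Vector fields are the derivations of \<open>C\<^sup>\<infinity>\<close>, one-forms are the \<open>C\<^sup>\<infinity>\<close>-linear functionals on
  vector fields, and a tensor \<open>T\<close> with \<open>p\<close> upper and \<open>q\<close> lower indices is a
  \<open>C\<^sup>\<infinity>\<close>-multilinear function of \<open>p\<close> one-forms and \<open>q\<close> vector fields: \<open>T (\<alpha>s, Xs)\<close> is the full
  contraction of the upper indices with \<open>\<alpha>s\<close> and of the lower indices with \<open>Xs\<close>, both in order.
  As HOL functions are total, every such object is required to vanish on arguments outside its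
  domain; this makes it unique as a HOL function.\<close>

type_synonym 'm vfield = "('m \<Rightarrow> real) \<Rightarrow> 'm \<Rightarrow> real"
type_synonym 'm form = "'m vfield \<Rightarrow> 'm \<Rightarrow> real"
type_synonym 'm tensor = "'m form list \<times> 'm vfield list \<Rightarrow> 'm \<Rightarrow> real"

definition fscale :: "('m \<Rightarrow> real) \<Rightarrow> ('k \<Rightarrow> 'm \<Rightarrow> real) \<Rightarrow> 'k \<Rightarrow> 'm \<Rightarrow> real"  (infixr "\<odot>" 75) where
  "f \<odot> T = (\<lambda>k. f * T k)"

definition vfields :: "('m, 'e::euclidean_space) chart set \<Rightarrow> 'm vfield set" where
  "vfields A = {X.
     (\<forall>f\<in>Cinf A. X f \<in> Cinf A) \<and> (\<forall>f. f \<notin> Cinf A \<longrightarrow> X f = 0) \<and>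
     (\<forall>f\<in>Cinf A. \<forall>g\<in>Cinf A. X (f + g) = X f + X g \<and> X (f * g) = f * X g + g * X f) \<and>
     (\<forall>c. \<forall>f\<in>Cinf A. X ((\<lambda>_. c) * f) = (\<lambda>_. c) * X f)}"

definition lie_bracket :: "'m vfield \<Rightarrow> 'm vfield \<Rightarrow> 'm vfield" where
  "lie_bracket X Y = (\<lambda>f. X (Y f) - Y (X f))"

definition one_forms :: "('m, 'e::euclidean_space) chart set \<Rightarrow> 'm form set" where
  "one_forms A = {\<alpha>.
     (\<forall>X\<in>vfields A. \<alpha> X \<in> Cinf A) \<and> (\<forall>X. X \<notin> vfields A \<longrightarrow> \<alpha> X = 0) \<and>
     (\<forall>X\<in>vfields A. \<forall>Y\<in>vfields A. \<alpha> (X + Y) = \<alpha> X + \<alpha> Y) \<and>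
     (\<forall>f\<in>Cinf A. \<forall>X\<in>vfields A. \<alpha> (f \<odot> X) = f * \<alpha> X)}"

definition is_tensor :: "('m, 'e::euclidean_space) chart set \<Rightarrow> nat \<Rightarrow> nat \<Rightarrow> 'm tensor \<Rightarrow> bool" where
  "is_tensor A p q T \<longleftrightarrow>
     (\<forall>\<alpha>s Xs. T (\<alpha>s, Xs) \<in> Cinf A) \<and>
     (\<forall>\<alpha>s Xs. \<not> (length \<alpha>s = p \<and> length Xs = q \<and> set \<alpha>s \<subseteq> one_forms A \<and> set Xs \<subseteq> vfields A)
        \<longrightarrow> T (\<alpha>s, Xs) = 0) \<and>
     (\<forall>\<alpha>s Xs. length \<alpha>s = p \<and> length Xs = q \<and> set \<alpha>s \<subseteq> one_forms A \<and> set Xs \<subseteq> vfields A \<longrightarrow>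
        (\<forall>i<p. \<forall>\<alpha>\<in>one_forms A. \<forall>\<beta>\<in>one_forms A. \<forall>f\<in>Cinf A.
           T (\<alpha>s[i := \<alpha> + \<beta>], Xs) = T (\<alpha>s[i := \<alpha>], Xs) + T (\<alpha>s[i := \<beta>], Xs) \<and>
           T (\<alpha>s[i := f \<odot> \<alpha>], Xs) = f * T (\<alpha>s[i := \<alpha>], Xs)) \<and>
        (\<forall>j<q. \<forall>X\<in>vfields A. \<forall>Y\<in>vfields A. \<forall>f\<in>Cinf A.
           T (\<alpha>s, Xs[j := X + Y]) = T (\<alpha>s, Xs[j := X]) + T (\<alpha>s, Xs[j := Y]) \<and>
           T (\<alpha>s, Xs[j := f \<odot> X]) = f * T (\<alpha>s, Xs[j := X])))"

definition two_form :: "('m, 'e::euclidean_space) chart set \<Rightarrow> 'm tensor \<Rightarrow> bool" where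
  "two_form A \<sigma> \<longleftrightarrow> is_tensor A 0 2 \<sigma> \<and>
     (\<forall>X\<in>vfields A. \<forall>Y\<in>vfields A. \<sigma> ([], [X, Y]) = - \<sigma> ([], [Y, X]))"

definition bivector :: "('m, 'e::euclidean_space) chart set \<Rightarrow> 'm tensor \<Rightarrow> bool" where
  "bivector A \<pi> \<longleftrightarrow> is_tensor A 2 0 \<pi> \<and>
     (\<forall>\<alpha>\<in>one_forms A. \<forall>\<beta>\<in>one_forms A. \<pi> ([\<alpha>, \<beta>], []) = - \<pi> ([\<beta>, \<alpha>], []))"

definition d0 :: "('m, 'e::euclidean_space) chart set \<Rightarrow> ('m \<Rightarrow> real) \<Rightarrow> 'm form" where
  "d0 A f = (\<lambda>X. if X \<in> vfields A then X f else 0)"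

definition d1 :: "('m, 'e::euclidean_space) chart set \<Rightarrow> 'm form \<Rightarrow> 'm tensor" where
  "d1 A \<alpha> = (\<lambda>(\<beta>s, Xs). case (\<beta>s, Xs) of
       ([], [X, Y]) \<Rightarrow> (if X \<in> vfields A \<and> Y \<in> vfields A
                        then X (\<alpha> Y) - Y (\<alpha> X) - \<alpha> (lie_bracket X Y) else 0)
     | _ \<Rightarrow> 0)"

text \<open>Convention: \<open>(\<alpha> \<and> \<beta>)\<^sub>l\<^sub>m = \<alpha>\<^sub>l \<beta>\<^sub>m - \<alpha>\<^sub>m \<beta>\<^sub>l\<close>, which matches the normalisation of \<open>d1\<close>,
  i.e. \<open>d (f \<beta>) = df \<and> \<beta> + f d\<beta>\<close>.\<close>

definition wedge :: "'m form \<Rightarrow> 'm form \<Rightarrow> 'm tensor" where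
  "wedge \<alpha> \<beta> = (\<lambda>(\<beta>s, Xs). case (\<beta>s, Xs) of
       ([], [X, Y]) \<Rightarrow> \<alpha> X * \<beta> Y - \<alpha> Y * \<beta> X
     | _ \<Rightarrow> 0)"

definition closed_two_form :: "('m, 'e::euclidean_space) chart set \<Rightarrow> 'm tensor \<Rightarrow> bool" where
  "closed_two_form A \<omega> \<longleftrightarrow> two_form A \<omega> \<and>
     (\<forall>X\<in>vfields A. \<forall>Y\<in>vfields A. \<forall>Z\<in>vfields A.
        X (\<omega> ([], [Y, Z])) + Y (\<omega> ([], [Z, X])) + Z (\<omega> ([], [X, Y]))
        - \<omega> ([], [lie_bracket X Y, Z]) - \<omega> ([], [lie_bracket Y Z, X])
        - \<omega> ([], [lie_bracket Z X, Y]) = 0)"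

text \<open>Nondegeneracy at every point; two vector fields agree at \<open>p\<close> iff they give the same
  derivatives at \<open>p\<close>.\<close>

definition symplectic_form :: "('m, 'e::euclidean_space) chart set \<Rightarrow> 'm tensor \<Rightarrow> bool" where
  "symplectic_form A \<omega> \<longleftrightarrow> closed_two_form A \<omega> \<and>
     (\<forall>p. \<forall>X\<in>vfields A. (\<forall>Y\<in>vfields A. \<omega> ([], [X, Y]) p = 0) \<longrightarrow> (\<forall>f\<in>Cinf A. X f p = 0))"

definition real_bilinear_on :: "('k \<Rightarrow> 'm \<Rightarrow> real) set \<Rightarrow>
    (('k \<Rightarrow> 'm \<Rightarrow> real) \<Rightarrow> ('k \<Rightarrow> 'm \<Rightarrow> real) \<Rightarrow> ('l \<Rightarrow> 'm \<Rightarrow> real)) \<Rightarrow> bool" where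
  "real_bilinear_on S F \<longleftrightarrow>
     (\<forall>x\<in>S. \<forall>y\<in>S. \<forall>z\<in>S. F (x + y) z = F x z + F y z \<and> F x (y + z) = F x y + F x z) \<and>
     (\<forall>c. \<forall>x\<in>S. \<forall>y\<in>S. F ((\<lambda>_. c) \<odot> x) y = (\<lambda>_. c) \<odot> F x y \<and> F x ((\<lambda>_. c) \<odot> y) = (\<lambda>_. c) \<odot> F x y)"

section \<open>Poisson structures\<close>

definition poisson_bracket ::
  "('m, 'e::euclidean_space) chart set \<Rightarrow> 'm tensor \<Rightarrow> ('m \<Rightarrow> real) \<Rightarrow> ('m \<Rightarrow> real) \<Rightarrow> 'm \<Rightarrow> real" where
  "poisson_bracket A \<pi> f g = \<pi> ([d0 A f, d0 A g], [])"

definition poisson_bivector :: "('m, 'e::euclidean_space) chart set \<Rightarrow> 'm tensor \<Rightarrow> bool" where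
  "poisson_bivector A \<pi> \<longleftrightarrow> bivector A \<pi> \<and>
     (\<forall>f\<in>Cinf A. \<forall>g\<in>Cinf A. \<forall>h\<in>Cinf A.
        poisson_bracket A \<pi> f (poisson_bracket A \<pi> g h)
        + poisson_bracket A \<pi> g (poisson_bracket A \<pi> h f)
        + poisson_bracket A \<pi> h (poisson_bracket A \<pi> f g) = 0)"

text \<open>\<open>(#\<alpha>)\<^sup>i = \<pi>\<^sup>j\<^sup>i \<alpha>\<^sub>j\<close>, as a derivation.\<close>

definition sharp :: "('m, 'e::euclidean_space) chart set \<Rightarrow> 'm tensor \<Rightarrow> 'm form \<Rightarrow> 'm vfield" where
  "sharp A \<pi> \<alpha> = (\<lambda>f. \<pi> ([\<alpha>, d0 A f], []))"

text \<open>\<open>\<pi>\<^sup>i\<^sup>j \<omega>\<^sub>j\<^sub>k = \<delta>\<^sup>i\<^sub>k\<close>, contracted with arbitrary \<open>\<alpha>\<^sub>i\<close> and \<open>X\<^sup>k\<close>; note \<open>\<pi>\<^sup>i\<^sup>j \<alpha>\<^sub>i = (#\<alpha>)\<^sup>j\<close>.\<close>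

definition inverse_of_form ::
  "('m, 'e::euclidean_space) chart set \<Rightarrow> 'm tensor \<Rightarrow> 'm tensor \<Rightarrow> bool" where
  "inverse_of_form A \<pi> \<omega> \<longleftrightarrow>
     (\<forall>\<alpha>\<in>one_forms A. \<forall>X\<in>vfields A. \<omega> ([], [sharp A \<pi> \<alpha>, X]) = \<alpha> X)"

definition koszul_bracket ::
  "('m, 'e::euclidean_space) chart set \<Rightarrow> 'm tensor \<Rightarrow> ('m form \<Rightarrow> 'm form \<Rightarrow> 'm form) \<Rightarrow> bool" where
  "koszul_bracket A \<pi> K \<longleftrightarrow>
     (\<forall>\<alpha>\<in>one_forms A. \<forall>\<beta>\<in>one_forms A. K \<alpha> \<beta> \<in> one_forms A \<and> K \<alpha> \<beta> = - K \<beta> \<alpha>) \<and>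
     real_bilinear_on (one_forms A) K \<and>
     (\<forall>\<alpha>\<in>one_forms A. \<forall>\<beta>\<in>one_forms A. \<forall>\<gamma>\<in>one_forms A.
        K \<alpha> (K \<beta> \<gamma>) + K \<beta> (K \<gamma> \<alpha>) + K \<gamma> (K \<alpha> \<beta>) = 0) \<and>
     (\<forall>\<alpha>\<in>one_forms A. \<forall>\<beta>\<in>one_forms A. \<forall>f\<in>Cinf A.
        K \<alpha> (f \<odot> \<beta>) = f \<odot> K \<alpha> \<beta> + sharp A \<pi> \<alpha> f \<odot> \<beta>) \<and>
     (\<forall>f\<in>Cinf A. \<forall>g\<in>Cinf A. K (d0 A f) (d0 A g) = d0 A (poisson_bracket A \<pi> f g))"

section \<open>Connections\<close>

text \<open>Leibniz rule for a derivation \<open>a\<close> on functions that acts as \<open>F\<close> on one-forms and as \<open>V\<close> on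
  vector fields, compatibly with contraction.\<close>

definition leibniz_extension :: "('m, 'e::euclidean_space) chart set \<Rightarrow>
    'm vfield \<Rightarrow> ('m form \<Rightarrow> 'm form) \<Rightarrow> ('m vfield \<Rightarrow> 'm vfield) \<Rightarrow> 'm tensor \<Rightarrow> 'm tensor" where
  "leibniz_extension A a F V T = (\<lambda>(\<beta>s, Xs).
     if set \<beta>s \<subseteq> one_forms A \<and> set Xs \<subseteq> vfields A then
       a (T (\<beta>s, Xs))
       - (\<Sum>i<length \<beta>s. T (\<beta>s[i := F (\<beta>s ! i)], Xs))
       - (\<Sum>j<length Xs. T (\<beta>s, Xs[j := V (Xs ! j)]))
     else 0)"

subsection \<open>Contravariant connections\<close>

definition contravariant_connection ::
  "('m, 'e::euclidean_space) chart set \<Rightarrow> 'm tensor \<Rightarrow> ('m form \<Rightarrow> 'm form \<Rightarrow> 'm form) \<Rightarrow> bool" where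
  "contravariant_connection A \<pi> D \<longleftrightarrow>
     (\<forall>\<alpha>\<in>one_forms A. \<forall>\<beta>\<in>one_forms A. D \<alpha> \<beta> \<in> one_forms A) \<and>
     real_bilinear_on (one_forms A) D \<and>
     (\<forall>f\<in>Cinf A. \<forall>\<alpha>\<in>one_forms A. \<forall>\<beta>\<in>one_forms A.
        D (f \<odot> \<alpha>) \<beta> = f \<odot> D \<alpha> \<beta> \<and>
        D \<alpha> (f \<odot> \<beta>) = f \<odot> D \<alpha> \<beta> + sharp A \<pi> \<alpha> f \<odot> \<beta>)"

definition contravariant_flat :: "('m, 'e::euclidean_space) chart set \<Rightarrow>
    ('m form \<Rightarrow> 'm form \<Rightarrow> 'm form) \<Rightarrow> ('m form \<Rightarrow> 'm form \<Rightarrow> 'm form) \<Rightarrow> bool" where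
  "contravariant_flat A K D \<longleftrightarrow>
     (\<forall>\<alpha>\<in>one_forms A. \<forall>\<beta>\<in>one_forms A. \<forall>\<gamma>\<in>one_forms A.
        D \<alpha> (D \<beta> \<gamma>) - D \<beta> (D \<alpha> \<gamma>) - D (K \<alpha> \<beta>) \<gamma> = 0)"

definition contravariant_torsion_free :: "('m, 'e::euclidean_space) chart set \<Rightarrow>
    ('m form \<Rightarrow> 'm form \<Rightarrow> 'm form) \<Rightarrow> ('m form \<Rightarrow> 'm form \<Rightarrow> 'm form) \<Rightarrow> bool" where
  "contravariant_torsion_free A K D \<longleftrightarrow>
     (\<forall>\<alpha>\<in>one_forms A. \<forall>\<beta>\<in>one_forms A. D \<alpha> \<beta> - D \<beta> \<alpha> = K \<alpha> \<beta>)"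

text \<open>Action on vector fields, from \<open>\<D>\<^sub>\<alpha> (\<beta>(X)) = (\<D>\<^sub>\<alpha> \<beta>)(X) + \<beta>(\<D>\<^sub>\<alpha> X)\<close> with \<open>\<beta> = df\<close>.\<close>

definition contravariant_vfield :: "('m, 'e::euclidean_space) chart set \<Rightarrow> 'm tensor \<Rightarrow>
    ('m form \<Rightarrow> 'm form \<Rightarrow> 'm form) \<Rightarrow> 'm form \<Rightarrow> 'm vfield \<Rightarrow> 'm vfield" where
  "contravariant_vfield A \<pi> D \<alpha> X = (\<lambda>f. sharp A \<pi> \<alpha> (X f) - D \<alpha> (d0 A f) X)"

definition contravariant_tensor :: "('m, 'e::euclidean_space) chart set \<Rightarrow> 'm tensor \<Rightarrow>
    ('m form \<Rightarrow> 'm form \<Rightarrow> 'm form) \<Rightarrow> 'm form \<Rightarrow> 'm tensor \<Rightarrow> 'm tensor" where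
  "contravariant_tensor A \<pi> D \<alpha> =
     leibniz_extension A (sharp A \<pi> \<alpha>) (D \<alpha>) (contravariant_vfield A \<pi> D \<alpha>)"

text \<open>\<open>T \<mapsto> \<D>\<^sup>i T\<close>: the new upper index \<open>i\<close> comes first.\<close>

definition contravariant_derivative :: "('m, 'e::euclidean_space) chart set \<Rightarrow> 'm tensor \<Rightarrow>
    ('m form \<Rightarrow> 'm form \<Rightarrow> 'm form) \<Rightarrow> 'm tensor \<Rightarrow> 'm tensor" where
  "contravariant_derivative A \<pi> D T = (\<lambda>(\<beta>s, Xs). case \<beta>s of
       [] \<Rightarrow> 0
     | \<alpha> # \<gamma>s \<Rightarrow> (if \<alpha> \<in> one_forms A then contravariant_tensor A \<pi> D \<alpha> T (\<gamma>s, Xs) else 0))"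

subsection \<open>Covariant connections\<close>

definition covariant_connection ::
  "('m, 'e::euclidean_space) chart set \<Rightarrow> ('m vfield \<Rightarrow> 'm vfield \<Rightarrow> 'm vfield) \<Rightarrow> bool" where
  "covariant_connection A N \<longleftrightarrow>
     (\<forall>X\<in>vfields A. \<forall>Y\<in>vfields A. N X Y \<in> vfields A) \<and>
     real_bilinear_on (vfields A) N \<and>
     (\<forall>f\<in>Cinf A. \<forall>X\<in>vfields A. \<forall>Y\<in>vfields A.
        N (f \<odot> X) Y = f \<odot> N X Y \<and>
        N X (f \<odot> Y) = f \<odot> N X Y + X f \<odot> Y)"

definition covariant_flat ::
  "('m, 'e::euclidean_space) chart set \<Rightarrow> ('m vfield \<Rightarrow> 'm vfield \<Rightarrow> 'm vfield) \<Rightarrow> bool" where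
  "covariant_flat A N \<longleftrightarrow>
     (\<forall>X\<in>vfields A. \<forall>Y\<in>vfields A. \<forall>Z\<in>vfields A.
        N X (N Y Z) - N Y (N X Z) - N (lie_bracket X Y) Z = 0)"

definition covariant_torsion_free ::
  "('m, 'e::euclidean_space) chart set \<Rightarrow> ('m vfield \<Rightarrow> 'm vfield \<Rightarrow> 'm vfield) \<Rightarrow> bool" where
  "covariant_torsion_free A N \<longleftrightarrow>
     (\<forall>X\<in>vfields A. \<forall>Y\<in>vfields A. N X Y - N Y X = lie_bracket X Y)"

definition covariant_form :: "('m, 'e::euclidean_space) chart set \<Rightarrow>
    ('m vfield \<Rightarrow> 'm vfield \<Rightarrow> 'm vfield) \<Rightarrow> 'm vfield \<Rightarrow> 'm form \<Rightarrow> 'm form" where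
  "covariant_form A N X \<beta> = (\<lambda>Y. if Y \<in> vfields A then X (\<beta> Y) - \<beta> (N X Y) else 0)"

definition covariant_tensor :: "('m, 'e::euclidean_space) chart set \<Rightarrow>
    ('m vfield \<Rightarrow> 'm vfield \<Rightarrow> 'm vfield) \<Rightarrow> 'm vfield \<Rightarrow> 'm tensor \<Rightarrow> 'm tensor" where
  "covariant_tensor A N X = leibniz_extension A X (covariant_form A N X) (N X)"

text \<open>\<open>T \<mapsto> T\<^sub>|\<^sub>a\<close>: the new lower index \<open>a\<close> comes last, so that iterating gives \<open>T\<^sub>|\<^sub>a\<^sub>b\<^sub>c\<close>.\<close>

definition covariant_derivative :: "('m, 'e::euclidean_space) chart set \<Rightarrow>
    ('m vfield \<Rightarrow> 'm vfield \<Rightarrow> 'm vfield) \<Rightarrow> 'm tensor \<Rightarrow> 'm tensor" where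
  "covariant_derivative A N T = (\<lambda>(\<beta>s, Xs).
     if Xs \<noteq> [] \<and> last Xs \<in> vfields A
     then covariant_tensor A N (last Xs) T (\<beta>s, butlast Xs) else 0)"

section \<open>Metacurvature\<close>

text \<open>The bracket of two one-forms; the bracket \<open>{f, \<sigma>} = \<D>\<^sub>d\<^sub>f \<sigma>\<close> is written out.\<close>

definition metacurvature_bracket :: "('m, 'e::euclidean_space) chart set \<Rightarrow> 'm tensor \<Rightarrow>
    ('m form \<Rightarrow> 'm form \<Rightarrow> 'm form) \<Rightarrow> ('m form \<Rightarrow> 'm form \<Rightarrow> 'm tensor) \<Rightarrow> bool" where
  "metacurvature_bracket A \<pi> D B \<longleftrightarrow>
     (\<forall>\<alpha>\<in>one_forms A. \<forall>\<beta>\<in>one_forms A. two_form A (B \<alpha> \<beta>) \<and> B \<alpha> \<beta> = B \<beta> \<alpha>) \<and>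
     real_bilinear_on (one_forms A) B \<and>
     (\<forall>f\<in>Cinf A. \<forall>\<alpha>\<in>one_forms A. \<forall>\<beta>\<in>one_forms A.
        B (f \<odot> \<alpha>) \<beta> = f \<odot> B \<alpha> \<beta> + wedge \<alpha> (D (d0 A f) \<beta>)) \<and>
     (\<forall>f\<in>Cinf A. \<forall>\<beta>\<in>one_forms A.
        d1 A (D (d0 A f) \<beta>) = B (d0 A f) \<beta> + contravariant_tensor A \<pi> D (d0 A f) (d1 A \<beta>))"

definition metacurvature :: "('m, 'e::euclidean_space) chart set \<Rightarrow> 'm tensor \<Rightarrow>
    ('m form \<Rightarrow> 'm form \<Rightarrow> 'm form) \<Rightarrow> ('m form \<Rightarrow> 'm form \<Rightarrow> 'm tensor) \<Rightarrow> 'm tensor \<Rightarrow> bool" where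
  "metacurvature A \<pi> D B M \<longleftrightarrow>
     is_tensor A 3 2 M \<and>
     (\<forall>\<alpha>\<in>one_forms A. \<forall>\<beta>\<in>one_forms A. \<forall>\<gamma>\<in>one_forms A. \<forall>X\<in>vfields A. \<forall>Y\<in>vfields A.
        M ([\<alpha>, \<beta>, \<gamma>], [X, Y]) = M ([\<beta>, \<alpha>, \<gamma>], [X, Y]) \<and>
        M ([\<alpha>, \<beta>, \<gamma>], [X, Y]) = M ([\<alpha>, \<gamma>, \<beta>], [X, Y]) \<and>
        M ([\<alpha>, \<beta>, \<gamma>], [X, Y]) = - M ([\<alpha>, \<beta>, \<gamma>], [Y, X])) \<and>
     (\<forall>f\<in>Cinf A. \<forall>\<beta>\<in>one_forms A. \<forall>\<gamma>\<in>one_forms A. \<forall>X\<in>vfields A. \<forall>Y\<in>vfields A.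
        M ([d0 A f, \<beta>, \<gamma>], [X, Y]) =
          contravariant_tensor A \<pi> D (d0 A f) (B \<beta> \<gamma>) ([], [X, Y])
          - B (D (d0 A f) \<beta>) \<gamma> ([], [X, Y])
          - B (D (d0 A f) \<gamma>) \<beta> ([], [X, Y]))"

end

theory Submission
  imports Defs
begin

text \<open>Write \<open>C\<close> for the smooth functions. Every object in the statement is \<open>C\<close>-linear in its
  one-form arguments, and a \<open>C\<close>-linear functional on one-forms that kills exact forms vanishes, by
  nondegeneracy of \<open>\<omega>\<close>; so \<open>M\<close> need only be computed on exact forms \<open>\<alpha> = df\<close>, \<open>\<beta> = dg\<close>, \<open>\<gamma> = dh\<close>,
  without local coordinates. There \<open>{f, \<sigma>} = D\<^sub>\<alpha> \<sigma>\<close> and \<open>{df, \<sigma>} = d (D\<^sub>\<alpha> \<sigma>) - D\<^sub>\<alpha> (d\<sigma>)\<close>.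

  Let \<open>a\<^sub>\<beta>\<close> be the endomorphism of vector fields dual to \<open>\<gamma> \<mapsto> D\<^sub>\<gamma> \<beta>\<close>. Closedness of \<open>\<omega>\<close> gives
  \<open>d\<beta> = a\<^sub>\<beta> \<cdot> \<omega> - D\<^sub>\<beta> \<omega>\<close>, hence \<open>D\<^sub>\<alpha> \<omega> = a\<^sub>\<alpha> \<cdot> \<omega>\<close> for exact \<open>\<alpha>\<close>, and flatness with vanishing torsion gives
  \<open>[D\<^sub>\<alpha>, a\<^sub>\<beta>] = a\<^bsub>D\<^sub>\<alpha> \<beta>\<^esub> - a\<^sub>\<alpha> a\<^sub>\<beta>\<close>. These combine to \<open>{\<alpha>, \<beta>} = D\<^sup>2\<omega>(\<alpha>, \<beta>) - \<omega>(a\<^sub>\<alpha> \<cdot>, a\<^sub>\<beta> \<cdot>) - \<omega>(a\<^sub>\<beta> \<cdot>, a\<^sub>\<alpha> \<cdot>)\<close>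
  for exact \<open>\<alpha>\<close>. In \<open>M(\<alpha>, \<beta>, \<gamma>)\<close> the terms quadratic in \<open>a\<close> then cancel and \<open>D\<^sup>3\<omega>(\<alpha>, \<beta>, \<gamma>)\<close> remains. The
  formula with \<open>\<pi>\<close> is the image of this one under \<open>\<sharp>\<close>, which intertwines \<open>D\<close> and \<open>\<nabla>\<close> and maps \<open>\<omega>\<close> to \<open>-\<pi>\<close>.\<close>

section \<open>Smooth functions, vector fields and one-forms\<close>

lemma frechet_derivative_cong_open:
  assumes "open S" "x \<in> S" "\<And>y. y \<in> S \<Longrightarrow> f y = g y"
  shows "frechet_derivative f (at x) = frechet_derivative g (at x)"
    and "f differentiable (at x) \<longleftrightarrow> g differentiable (at x)"
proof -
  \<comment> \<open>The two functions have the same set of derivatives at \<open>x\<close>, so the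
    choice behind \<open>frechet_derivative\<close> returns the same value even where neither is
    differentiable.\<close>
  have "(f has_derivative F) (at x) \<longleftrightarrow> (g has_derivative F) (at x)" for F
    using has_derivative_transform_within_open[OF _ assms(1,2), of f F UNIV g]
      has_derivative_transform_within_open[OF _ assms(1,2), of g F UNIV f] assms(3) by auto
  then show "frechet_derivative f (at x) = frechet_derivative g (at x)"
    and "f differentiable (at x) \<longleftrightarrow> g differentiable (at x)"
    by (simp_all add: frechet_derivative_def differentiable_def)
qed

lemma Ck_on_cong:
  assumes "open S"
  shows "(\<And>x. x \<in> S \<Longrightarrow> f x = g x) \<Longrightarrow> Ck_on n S f \<longleftrightarrow> Ck_on n S g"
proof (induction n arbitrary: f g)
  case 0
  then show ?case by (simp cong: continuous_on_cong)
next
  case (Suc n)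
  have "Ck_on n S (\<lambda>x. frechet_derivative f (at x) v) \<longleftrightarrow> Ck_on n S (\<lambda>x. frechet_derivative g (at x) v)" for v
    by (rule Suc.IH) (simp add: frechet_derivative_cong_open(1)[OF assms _ Suc.prems])
  then show ?case
    using frechet_derivative_cong_open(2)[OF assms _ Suc.prems] by simp
qed

text \<open>The recursion does not list the lower orders: at order zero differentiability supplies
  continuity, and above it the claim passes to the directional derivatives. The product rule relies
  on this, since its formula also contains undifferentiated factors.\<close>

lemma Ck_on_SucD: "Ck_on (Suc n) S f \<Longrightarrow> Ck_on n S f"
proof (induction n arbitrary: f)
  case 0
  then show ?case
    by (auto intro!: continuous_at_imp_continuous_on differentiable_imp_continuous_within)
next
  case (Suc n)
  then show ?case by (metis Ck_on.simps(2))
qed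

lemma Ck_on_const: "Ck_on n S (\<lambda>_. c)"
  by (induction n arbitrary: c) auto

lemma Ck_on_add:
  assumes "open S"
  shows "Ck_on n S f \<Longrightarrow> Ck_on n S g \<Longrightarrow> Ck_on n S (\<lambda>x. f x + g x)"
proof (induction n arbitrary: f g)
  case 0
  then show ?case by (simp add: continuous_on_add)
next
  case (Suc n)
  have "frechet_derivative (\<lambda>x. f x + g x) (at x) v
      = frechet_derivative f (at x) v + frechet_derivative g (at x) v" if "x \<in> S" for x v
  proof -
    have "((\<lambda>x. f x + g x) has_derivative
        (\<lambda>v. frechet_derivative f (at x) v + frechet_derivative g (at x) v)) (at x)"
      using Suc.prems that by (intro has_derivative_add) (auto simp flip: frechet_derivative_works)
    then show ?thesis
      by (simp flip: frechet_derivative_at)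
  qed
  moreover have "Ck_on n S (\<lambda>x. frechet_derivative f (at x) v + frechet_derivative g (at x) v)" for v
    using Suc.prems by (intro Suc.IH) auto
  ultimately have "Ck_on n S (\<lambda>x. frechet_derivative (\<lambda>x. f x + g x) (at x) v)" for v
    by (subst Ck_on_cong[OF assms]) auto
  then show ?case
    using Suc.prems by auto
qed

lemma Ck_on_mult:
  fixes f g :: "'a::real_normed_vector \<Rightarrow> real"
  assumes "open S"
  shows "Ck_on n S f \<Longrightarrow> Ck_on n S g \<Longrightarrow> Ck_on n S (\<lambda>x. f x * g x)"
proof (induction n arbitrary: f g)
  case 0
  then show ?case by (simp add: continuous_on_mult)
next
  case (Suc n)
  have "frechet_derivative (\<lambda>x. f x * g x) (at x) v
      = f x * frechet_derivative g (at x) v + frechet_derivative f (at x) v * g x" if "x \<in> S" for x v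
  proof -
    have "((\<lambda>x. f x * g x) has_derivative
        (\<lambda>v. f x * frechet_derivative g (at x) v + frechet_derivative f (at x) v * g x)) (at x)"
      using Suc.prems that by (intro has_derivative_mult) (auto simp flip: frechet_derivative_works)
    then show ?thesis
      by (simp flip: frechet_derivative_at)
  qed
  moreover have "Ck_on n S (\<lambda>x. f x * frechet_derivative g (at x) v + frechet_derivative f (at x) v * g x)" for v
    using Suc.prems Ck_on_SucD[OF Suc.prems(1)] Ck_on_SucD[OF Suc.prems(2)]
    by (intro Ck_on_add[OF assms] Suc.IH) auto
  ultimately have "Ck_on n S (\<lambda>x. frechet_derivative (\<lambda>x. f x * g x) (at x) v)" for v
    by (subst Ck_on_cong[OF assms]) auto
  then show ?case
    using Suc.prems by auto
qed

lemma fscale_apply [simp]: "(f \<odot> T) k = f * T k"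
  by (simp add: fscale_def)

section \<open>The ring of smooth functions and linearity over it\<close>

locale atlas =
  fixes A :: "('m::{t2_space,second_countable_topology}, 'e::euclidean_space) chart set"
  assumes smooth_atlas: "smooth_atlas A"
begin

lemma open_chart_image: "(U, \<phi>) \<in> A \<Longrightarrow> open (\<phi> ` U)"
  using smooth_atlas by (auto simp: smooth_atlas_def)

lemma Cinf_add: "f \<in> Cinf A \<Longrightarrow> g \<in> Cinf A \<Longrightarrow> f + g \<in> Cinf A"
  and Cinf_mult: "f \<in> Cinf A \<Longrightarrow> g \<in> Cinf A \<Longrightarrow> f * g \<in> Cinf A"
  and Cinf_const: "(\<lambda>_. c) \<in> Cinf A"
  unfolding Cinf_def smooth_on_def
  by (auto simp: o_def plus_fun_def times_fun_def Ck_on_const split_beta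
      intro!: Ck_on_add Ck_on_mult open_chart_image)

lemma Cinf_0: "0 \<in> Cinf A" and Cinf_1: "1 \<in> Cinf A"
  using Cinf_const[of 0] Cinf_const[of 1] by (simp_all add: zero_fun_def one_fun_def)

lemma Cinf_uminus: "f \<in> Cinf A \<Longrightarrow> - f \<in> Cinf A"
  using Cinf_mult[OF Cinf_const[of "-1"], of f] by (simp add: fun_Compl_def times_fun_def)

lemma Cinf_diff: "f \<in> Cinf A \<Longrightarrow> g \<in> Cinf A \<Longrightarrow> f - g \<in> Cinf A"
  using Cinf_add[OF _ Cinf_uminus, of f g] by simp

abbreviation "C \<equiv> Cinf A"
abbreviation "\<XX> \<equiv> vfields A"
abbreviation "\<Omega> \<equiv> one_forms A"

lemmas Cinf_intros [intro, simp] = Cinf_add Cinf_mult Cinf_const Cinf_0 Cinf_1 Cinf_uminus Cinf_diff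

text \<open>Parametrised by the module \<open>S\<close>, so that one notion serves functionals on
  vector fields (one-forms, lower slots of tensors) as well as functionals on one-forms.\<close>

definition Cinf_linear :: "('k \<Rightarrow> 'm \<Rightarrow> real) set \<Rightarrow> (('k \<Rightarrow> 'm \<Rightarrow> real) \<Rightarrow> 'm \<Rightarrow> real) \<Rightarrow> bool" where
  "Cinf_linear S T \<longleftrightarrow>
     (\<forall>x\<in>S. T x \<in> C) \<and>
     (\<forall>x\<in>S. \<forall>y\<in>S. T (x + y) = T x + T y) \<and> (\<forall>f\<in>C. \<forall>x\<in>S. T (f \<odot> x) = f * T x)"

lemma scale_zero: "(0 \<odot> x :: 'k \<Rightarrow> 'm \<Rightarrow> real) = 0"
  and scale_minus_one: "(- 1 \<odot> x :: 'k \<Rightarrow> 'm \<Rightarrow> real) = - x"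
  by (simp_all add: fun_eq_iff)

lemma Cinf_linearD:
  assumes "Cinf_linear S T"
  shows "x \<in> S \<Longrightarrow> T x \<in> C"
    and "x \<in> S \<Longrightarrow> y \<in> S \<Longrightarrow> T (x + y) = T x + T y"
    and "f \<in> C \<Longrightarrow> x \<in> S \<Longrightarrow> T (f \<odot> x) = f * T x"
    and "x \<in> S \<Longrightarrow> T 0 = 0"
    and "x \<in> S \<Longrightarrow> T (- x) = - T x"
    and "x \<in> S \<Longrightarrow> y \<in> S \<Longrightarrow> - y \<in> S \<Longrightarrow> T (x - y) = T x - T y"
proof -
  show *: "x \<in> S \<Longrightarrow> T x \<in> C" "x \<in> S \<Longrightarrow> y \<in> S \<Longrightarrow> T (x + y) = T x + T y"
    "f \<in> C \<Longrightarrow> x \<in> S \<Longrightarrow> T (f \<odot> x) = f * T x" for x y f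
    using assms by (auto simp: Cinf_linear_def)
  show "x \<in> S \<Longrightarrow> T 0 = 0" and **: "x \<in> S \<Longrightarrow> T (- x) = - T x" for x
    using *(3)[of 0 x] *(3)[of "- 1" x] by (simp_all add: scale_zero scale_minus_one)
  show "x \<in> S \<Longrightarrow> y \<in> S \<Longrightarrow> - y \<in> S \<Longrightarrow> T (x - y) = T x - T y"
    using *(2)[of x "- y"] **[of y] by simp
qed

section \<open>Vector fields as derivations\<close>

lemma vfield_closed [simp]: "X \<in> \<XX> \<Longrightarrow> f \<in> C \<Longrightarrow> X f \<in> C"
  and vfield_outside: "X \<in> \<XX> \<Longrightarrow> f \<notin> C \<Longrightarrow> X f = 0"
  and vfield_add: "X \<in> \<XX> \<Longrightarrow> f \<in> C \<Longrightarrow> g \<in> C \<Longrightarrow> X (f + g) = X f + X g"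
  and vfield_mult: "X \<in> \<XX> \<Longrightarrow> f \<in> C \<Longrightarrow> g \<in> C \<Longrightarrow> X (f * g) = f * X g + g * X f"
  and vfield_const_mult: "X \<in> \<XX> \<Longrightarrow> f \<in> C \<Longrightarrow> X ((\<lambda>_. c) * f) = (\<lambda>_. c) * X f"
  unfolding vfields_def by blast+

lemma vfield_const:
  assumes "X \<in> \<XX>" shows "X (\<lambda>_. c) = 0"
proof -
  have "X 1 = X 1 + X 1"
    using vfield_mult[OF assms, of 1 1] by simp
  moreover have "X ((\<lambda>_. c) * 1) = (\<lambda>_. c) * X 1"
    by (rule vfield_const_mult) (use assms in auto)
  ultimately show ?thesis by simp
qed

lemma vfield_0: "X \<in> \<XX> \<Longrightarrow> X 0 = 0"
  using vfield_const[of X 0] by (simp add: zero_fun_def)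

lemma vfield_uminus: "X \<in> \<XX> \<Longrightarrow> f \<in> C \<Longrightarrow> X (- f) = - X f"
  using vfield_const_mult[of X f "-1"] by (simp add: times_fun_def fun_Compl_def)

lemma vfield_diff: "X \<in> \<XX> \<Longrightarrow> f \<in> C \<Longrightarrow> g \<in> C \<Longrightarrow> X (f - g) = X f - X g"
  using vfield_add[of X f "- g"] vfield_uminus[of X g] by simp

lemmas vfield_simps = vfield_add vfield_mult vfield_const vfield_0 vfield_uminus vfield_diff

lemma vfieldI:
  assumes "\<And>f. f \<in> C \<Longrightarrow> X f \<in> C" "\<And>f. f \<notin> C \<Longrightarrow> X f = 0"
    "\<And>f g. f \<in> C \<Longrightarrow> g \<in> C \<Longrightarrow> X (f + g) = X f + X g"
    "\<And>f g. f \<in> C \<Longrightarrow> g \<in> C \<Longrightarrow> X (f * g) = f * X g + g * X f"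
    "\<And>c f. f \<in> C \<Longrightarrow> X ((\<lambda>_. c) * f) = (\<lambda>_. c) * X f"
  shows "X \<in> \<XX>"
  unfolding vfields_def mem_Collect_eq using assms by (intro conjI ballI allI impI)

text \<open>By the convention on total functions both sides vanish off \<open>C\<close>, so
  agreement on smooth functions is equality in HOL. \<open>one_form_eqI\<close> is the same device
  one level up.\<close>

lemma vfield_eqI:
  assumes "X \<in> \<XX>" "Y \<in> \<XX>" "\<And>f. f \<in> C \<Longrightarrow> X f = Y f"
  shows "X = Y"
proof
  fix f show "X f = Y f"
    using assms(3)[of f] vfield_outside[OF assms(1), of f] vfield_outside[OF assms(2), of f]
    by (cases "f \<in> C") simp_all
qed

lemma vfields_0 [simp]: "0 \<in> \<XX>"
  by (rule vfieldI) auto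

lemma vfields_add [simp]: "X \<in> \<XX> \<Longrightarrow> Y \<in> \<XX> \<Longrightarrow> X + Y \<in> \<XX>"
  by (rule vfieldI) (auto simp: vfield_simps[of X] vfield_simps[of Y]
      vfield_outside[of X] vfield_outside[of Y] algebra_simps)

lemma vfields_scale [simp]: "f \<in> C \<Longrightarrow> X \<in> \<XX> \<Longrightarrow> f \<odot> X \<in> \<XX>"
  by (rule vfieldI) (auto simp: vfield_simps[of X] vfield_outside[of X] algebra_simps)

lemma vfields_uminus [simp]: "X \<in> \<XX> \<Longrightarrow> - X \<in> \<XX>"
  using vfields_scale[of "- 1" X] by (simp add: scale_minus_one)

lemma vfields_diff [simp]: "X \<in> \<XX> \<Longrightarrow> Y \<in> \<XX> \<Longrightarrow> X - Y \<in> \<XX>"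
  using vfields_add[of X "- Y"] by simp

lemma vfields_lie_bracket [simp]: "X \<in> \<XX> \<Longrightarrow> Y \<in> \<XX> \<Longrightarrow> lie_bracket X Y \<in> \<XX>"
  by (rule vfieldI) (auto simp: lie_bracket_def vfield_simps[of X] vfield_simps[of Y]
      vfield_outside[of X] vfield_outside[of Y] algebra_simps)

section \<open>The module of one-forms\<close>

lemma one_form_linear: "\<alpha> \<in> \<Omega> \<Longrightarrow> Cinf_linear \<XX> \<alpha>"
  by (simp add: one_forms_def Cinf_linear_def)

lemma one_form_outside: "\<alpha> \<in> \<Omega> \<Longrightarrow> X \<notin> \<XX> \<Longrightarrow> \<alpha> X = 0"
  by (simp add: one_forms_def)

lemma one_formI: "Cinf_linear \<XX> \<alpha> \<Longrightarrow> (\<And>X. X \<notin> \<XX> \<Longrightarrow> \<alpha> X = 0) \<Longrightarrow> \<alpha> \<in> \<Omega>"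
  by (simp add: one_forms_def Cinf_linear_def)

lemma one_form_eqI:
  assumes "\<alpha> \<in> \<Omega>" "\<beta> \<in> \<Omega>" "\<And>X. X \<in> \<XX> \<Longrightarrow> \<alpha> X = \<beta> X"
  shows "\<alpha> = \<beta>"
proof
  fix X show "\<alpha> X = \<beta> X"
    using assms(3)[of X] one_form_outside[OF assms(1), of X] one_form_outside[OF assms(2), of X]
    by (cases "X \<in> \<XX>") simp_all
qed

lemma one_form_closed [simp]: "\<alpha> \<in> \<Omega> \<Longrightarrow> X \<in> \<XX> \<Longrightarrow> \<alpha> X \<in> C"
  and one_form_add: "\<alpha> \<in> \<Omega> \<Longrightarrow> X \<in> \<XX> \<Longrightarrow> Y \<in> \<XX> \<Longrightarrow> \<alpha> (X + Y) = \<alpha> X + \<alpha> Y"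
  and one_form_scale: "\<alpha> \<in> \<Omega> \<Longrightarrow> f \<in> C \<Longrightarrow> X \<in> \<XX> \<Longrightarrow> \<alpha> (f \<odot> X) = f * \<alpha> X"
  and one_form_uminus: "\<alpha> \<in> \<Omega> \<Longrightarrow> X \<in> \<XX> \<Longrightarrow> \<alpha> (- X) = - \<alpha> X"
  and one_form_diff: "\<alpha> \<in> \<Omega> \<Longrightarrow> X \<in> \<XX> \<Longrightarrow> Y \<in> \<XX> \<Longrightarrow> \<alpha> (X - Y) = \<alpha> X - \<alpha> Y"
  using Cinf_linearD[OF one_form_linear[of \<alpha>]] by simp_all

lemma one_form_0: "\<alpha> \<in> \<Omega> \<Longrightarrow> \<alpha> 0 = 0"
  by (rule Cinf_linearD(4)[OF one_form_linear vfields_0])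

lemmas one_form_simps = one_form_add one_form_scale one_form_0 one_form_uminus one_form_diff

lemma one_forms_0 [simp]: "0 \<in> \<Omega>"
  by (rule one_formI) (auto simp: Cinf_linear_def)

lemma one_forms_add [simp]: "\<alpha> \<in> \<Omega> \<Longrightarrow> \<beta> \<in> \<Omega> \<Longrightarrow> \<alpha> + \<beta> \<in> \<Omega>"
  by (rule one_formI) (auto simp: Cinf_linear_def one_form_simps[of \<alpha>] one_form_simps[of \<beta>]
      one_form_outside[of \<alpha>] one_form_outside[of \<beta>] algebra_simps)

lemma one_forms_scale [simp]: "f \<in> C \<Longrightarrow> \<alpha> \<in> \<Omega> \<Longrightarrow> f \<odot> \<alpha> \<in> \<Omega>"
  by (rule one_formI)
    (auto simp: Cinf_linear_def one_form_simps[of \<alpha>] one_form_outside[of \<alpha>] algebra_simps)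

lemma one_forms_uminus [simp]: "\<alpha> \<in> \<Omega> \<Longrightarrow> - \<alpha> \<in> \<Omega>"
  using one_forms_scale[of "- 1" \<alpha>] by (simp add: scale_minus_one)

lemma one_forms_diff [simp]: "\<alpha> \<in> \<Omega> \<Longrightarrow> \<beta> \<in> \<Omega> \<Longrightarrow> \<alpha> - \<beta> \<in> \<Omega>"
  using one_forms_add[of \<alpha> "- \<beta>"] by simp

section \<open>Multilinearity of tensors\<close>

lemma tensor_closed: "is_tensor A p q T \<Longrightarrow> T (\<alpha>s, Xs) \<in> C"
  unfolding is_tensor_def by (drule conjunct1) simp

lemma tensor_outside: "is_tensor A p q T \<Longrightarrow>
    \<not> (length \<alpha>s = p \<and> length Xs = q \<and> set \<alpha>s \<subseteq> \<Omega> \<and> set Xs \<subseteq> \<XX>) \<Longrightarrow> T (\<alpha>s, Xs) = 0"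
  unfolding is_tensor_def by (drule conjunct2, drule conjunct1, blast)

lemma tensor_lower:
  assumes T: "is_tensor A p q T" "length \<alpha>s = p" "length Xs = q" "set \<alpha>s \<subseteq> \<Omega>" "set Xs \<subseteq> \<XX>"
    "j < q" "X \<in> \<XX>" "Y \<in> \<XX>" "f \<in> C"
  shows "T (\<alpha>s, Xs[j := X + Y]) = T (\<alpha>s, Xs[j := X]) + T (\<alpha>s, Xs[j := Y])"
    and "T (\<alpha>s, Xs[j := f \<odot> X]) = f * T (\<alpha>s, Xs[j := X])"
proof -
  have *: "length \<alpha>s = p \<and> length Xs = q \<and> set \<alpha>s \<subseteq> \<Omega> \<and> set Xs \<subseteq> \<XX>"
    using T by simp
  note ** = T(1)[unfolded is_tensor_def, THEN conjunct2, THEN conjunct2, THEN spec, THEN spec,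
      THEN mp, OF *, THEN conjunct2, rule_format, OF T(6-9)]
  show "T (\<alpha>s, Xs[j := X + Y]) = T (\<alpha>s, Xs[j := X]) + T (\<alpha>s, Xs[j := Y])" "T (\<alpha>s, Xs[j := f \<odot> X]) = f * T (\<alpha>s, Xs[j := X])"
    by (fact **[THEN conjunct1], fact **[THEN conjunct2])
qed

lemma tensor_upper:
  assumes T: "is_tensor A p q T" "length \<alpha>s = p" "length Xs = q" "set \<alpha>s \<subseteq> \<Omega>" "set Xs \<subseteq> \<XX>"
    "i < p" "\<alpha> \<in> \<Omega>" "\<beta> \<in> \<Omega>" "f \<in> C"
  shows "T (\<alpha>s[i := \<alpha> + \<beta>], Xs) = T (\<alpha>s[i := \<alpha>], Xs) + T (\<alpha>s[i := \<beta>], Xs)"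
    and "T (\<alpha>s[i := f \<odot> \<alpha>], Xs) = f * T (\<alpha>s[i := \<alpha>], Xs)"
proof -
  have *: "length \<alpha>s = p \<and> length Xs = q \<and> set \<alpha>s \<subseteq> \<Omega> \<and> set Xs \<subseteq> \<XX>"
    using T by simp
  note ** = T(1)[unfolded is_tensor_def, THEN conjunct2, THEN conjunct2, THEN spec, THEN spec,
      THEN mp, OF *, THEN conjunct1, rule_format, OF T(6-9)]
  show "T (\<alpha>s[i := \<alpha> + \<beta>], Xs) = T (\<alpha>s[i := \<alpha>], Xs) + T (\<alpha>s[i := \<beta>], Xs)" "T (\<alpha>s[i := f \<odot> \<alpha>], Xs) = f * T (\<alpha>s[i := \<alpha>], Xs)"
    by (fact **[THEN conjunct1], fact **[THEN conjunct2])
qed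

section \<open>Differentials of functions\<close>

lemma d0_apply: "X \<in> \<XX> \<Longrightarrow> d0 A f X = X f"
  by (simp add: d0_def)

text \<open>Vector fields are zero off \<open>C\<close> by convention. Hence \<open>d0 A f\<close>
  is a one-form for every \<open>f\<close>, and facts about one-forms apply to it without a
  smoothness condition.\<close>

lemma d0_outside: "f \<notin> C \<Longrightarrow> d0 A f = 0"
  by (intro ext) (auto simp: d0_def dest: vfield_outside)

lemma d0_one_form [simp]: "d0 A f \<in> \<Omega>"
proof (cases "f \<in> C")
  case True
  then show ?thesis by (intro one_formI) (auto simp: Cinf_linear_def d0_def)
qed (simp add: d0_outside)

lemma d0_add: "f \<in> C \<Longrightarrow> g \<in> C \<Longrightarrow> d0 A (f + g) = d0 A f + d0 A g"
  and d0_mult: "f \<in> C \<Longrightarrow> g \<in> C \<Longrightarrow> d0 A (f * g) = f \<odot> d0 A g + g \<odot> d0 A f"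
  and d0_const: "d0 A (\<lambda>_. c) = 0"
  by (intro ext; simp add: d0_def vfield_add vfield_mult vfield_const)+

end

section \<open>Symplectic duality\<close>

locale symplectic_poisson = atlas A
  for A :: "('m::{t2_space,second_countable_topology}, 'e::euclidean_space) chart set" +
  fixes \<pi> \<omega> :: "'m tensor"
  assumes poisson: "poisson_bivector A \<pi>"
    and symplectic: "symplectic_form A \<omega>"
    and inverse: "inverse_of_form A \<pi> \<omega>"
begin

abbreviation sharp' ("\<sharp>") where "\<sharp> \<equiv> sharp A \<pi>"
abbreviation "w X Y \<equiv> \<omega> ([], [X, Y])"
abbreviation "P \<alpha> \<beta> \<equiv> \<pi> ([\<alpha>, \<beta>], [])"

section \<open>Bilinearity of the symplectic form and of the bivector\<close>

lemma \<omega>_tensor: "is_tensor A 0 2 \<omega>"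
  and \<omega>_antisym: "X \<in> \<XX> \<Longrightarrow> Y \<in> \<XX> \<Longrightarrow> w X Y = - w Y X"
  using symplectic unfolding symplectic_form_def closed_two_form_def two_form_def by blast+

lemma \<pi>_tensor: "is_tensor A 2 0 \<pi>"
  and \<pi>_antisym: "\<alpha> \<in> \<Omega> \<Longrightarrow> \<beta> \<in> \<Omega> \<Longrightarrow> P \<alpha> \<beta> = - P \<beta> \<alpha>"
  using poisson unfolding poisson_bivector_def bivector_def by blast+

lemma \<omega>_outside: "X \<notin> \<XX> \<or> Y \<notin> \<XX> \<Longrightarrow> w X Y = 0"
  and \<omega>_closed [simp]: "w X Y \<in> C"
  using tensor_outside[OF \<omega>_tensor, of "[]" "[X, Y]"] tensor_closed[OF \<omega>_tensor] by auto

lemma \<omega>_linear: "X \<in> \<XX> \<Longrightarrow> Cinf_linear \<XX> (w X)" "Y \<in> \<XX> \<Longrightarrow> Cinf_linear \<XX> (\<lambda>X. w X Y)"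
proof -
  \<comment> \<open>Positions 1 and 0 select the second and the first argument; the final 0 is a
    dummy scalar.\<close>
  have *: "w X (Y + Z) = w X Y + w X Z" "w (X + Z) Y = w X Y + w Z Y"
    if "X \<in> \<XX>" "Y \<in> \<XX>" "Z \<in> \<XX>" for X Y Z
    using tensor_lower(1)[OF \<omega>_tensor, of "[]" "[X, Y]" 1 Y Z 0]
      tensor_lower(1)[OF \<omega>_tensor, of "[]" "[X, Y]" 0 X Z 0] that by simp_all
  have **: "w X (f \<odot> Y) = f * w X Y" "w (f \<odot> X) Y = f * w X Y"
    if "X \<in> \<XX>" "Y \<in> \<XX>" "f \<in> C" for X Y f
    using tensor_lower(2)[OF \<omega>_tensor, of "[]" "[X, Y]" 1 Y 0 f]
      tensor_lower(2)[OF \<omega>_tensor, of "[]" "[X, Y]" 0 X 0 f] that by simp_all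
  show "X \<in> \<XX> \<Longrightarrow> Cinf_linear \<XX> (w X)" "Y \<in> \<XX> \<Longrightarrow> Cinf_linear \<XX> (\<lambda>X. w X Y)"
    by (simp_all add: Cinf_linear_def * **)
qed

lemma \<pi>_closed [simp]: "P \<alpha> \<beta> \<in> C"
  using tensor_closed[OF \<pi>_tensor] by auto

lemma \<pi>_linear: "\<alpha> \<in> \<Omega> \<Longrightarrow> Cinf_linear \<Omega> (P \<alpha>)" "\<beta> \<in> \<Omega> \<Longrightarrow> Cinf_linear \<Omega> (\<lambda>\<alpha>. P \<alpha> \<beta>)"
proof -
  have *: "P \<alpha> (\<beta> + \<gamma>) = P \<alpha> \<beta> + P \<alpha> \<gamma>" "P (\<alpha> + \<gamma>) \<beta> = P \<alpha> \<beta> + P \<gamma> \<beta>"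
    if "\<alpha> \<in> \<Omega>" "\<beta> \<in> \<Omega>" "\<gamma> \<in> \<Omega>" for \<alpha> \<beta> \<gamma>
    using tensor_upper(1)[OF \<pi>_tensor, of "[\<alpha>, \<beta>]" "[]" 1 \<beta> \<gamma> 0]
      tensor_upper(1)[OF \<pi>_tensor, of "[\<alpha>, \<beta>]" "[]" 0 \<alpha> \<gamma> 0] that by simp_all
  have **: "P \<alpha> (f \<odot> \<beta>) = f * P \<alpha> \<beta>" "P (f \<odot> \<alpha>) \<beta> = f * P \<alpha> \<beta>"
    if "\<alpha> \<in> \<Omega>" "\<beta> \<in> \<Omega>" "f \<in> C" for \<alpha> \<beta> f
    using tensor_upper(2)[OF \<pi>_tensor, of "[\<alpha>, \<beta>]" "[]" 1 \<beta> 0 f]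
      tensor_upper(2)[OF \<pi>_tensor, of "[\<alpha>, \<beta>]" "[]" 0 \<alpha> 0 f] that by simp_all
  show "\<alpha> \<in> \<Omega> \<Longrightarrow> Cinf_linear \<Omega> (P \<alpha>)" "\<beta> \<in> \<Omega> \<Longrightarrow> Cinf_linear \<Omega> (\<lambda>\<alpha>. P \<alpha> \<beta>)"
    by (simp_all add: Cinf_linear_def * **)
qed

lemma \<omega>_simps:
  "X \<in> \<XX> \<Longrightarrow> X' \<in> \<XX> \<Longrightarrow> Y \<in> \<XX> \<Longrightarrow> w (X + X') Y = w X Y + w X' Y"
  "f \<in> C \<Longrightarrow> X \<in> \<XX> \<Longrightarrow> Y \<in> \<XX> \<Longrightarrow> w (f \<odot> X) Y = f * w X Y"
  "X \<in> \<XX> \<Longrightarrow> Y \<in> \<XX> \<Longrightarrow> w (- X) Y = - w X Y"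
  "X \<in> \<XX> \<Longrightarrow> X' \<in> \<XX> \<Longrightarrow> Y \<in> \<XX> \<Longrightarrow> w (X - X') Y = w X Y - w X' Y"
  "X \<in> \<XX> \<Longrightarrow> Y \<in> \<XX> \<Longrightarrow> Y' \<in> \<XX> \<Longrightarrow> w X (Y + Y') = w X Y + w X Y'"
  "f \<in> C \<Longrightarrow> X \<in> \<XX> \<Longrightarrow> Y \<in> \<XX> \<Longrightarrow> w X (f \<odot> Y) = f * w X Y"
  "X \<in> \<XX> \<Longrightarrow> Y \<in> \<XX> \<Longrightarrow> w X (- Y) = - w X Y"
  "X \<in> \<XX> \<Longrightarrow> Y \<in> \<XX> \<Longrightarrow> Y' \<in> \<XX> \<Longrightarrow> w X (Y - Y') = w X Y - w X Y'"
  by (rule Cinf_linearD[OF \<omega>_linear(1)] Cinf_linearD[OF \<omega>_linear(2)]; simp)+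

lemma \<pi>_simps:
  "\<alpha> \<in> \<Omega> \<Longrightarrow> \<alpha>' \<in> \<Omega> \<Longrightarrow> \<beta> \<in> \<Omega> \<Longrightarrow> P (\<alpha> + \<alpha>') \<beta> = P \<alpha> \<beta> + P \<alpha>' \<beta>"
  "f \<in> C \<Longrightarrow> \<alpha> \<in> \<Omega> \<Longrightarrow> \<beta> \<in> \<Omega> \<Longrightarrow> P (f \<odot> \<alpha>) \<beta> = f * P \<alpha> \<beta>"
  "\<alpha> \<in> \<Omega> \<Longrightarrow> \<beta> \<in> \<Omega> \<Longrightarrow> \<beta>' \<in> \<Omega> \<Longrightarrow> P \<alpha> (\<beta> + \<beta>') = P \<alpha> \<beta> + P \<alpha> \<beta>'"
  "f \<in> C \<Longrightarrow> \<alpha> \<in> \<Omega> \<Longrightarrow> \<beta> \<in> \<Omega> \<Longrightarrow> P \<alpha> (f \<odot> \<beta>) = f * P \<alpha> \<beta>"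
  by (rule Cinf_linearD[OF \<pi>_linear(1)] Cinf_linearD[OF \<pi>_linear(2)]; simp)+

lemma \<pi>_0: "\<alpha> \<in> \<Omega> \<Longrightarrow> P \<alpha> 0 = 0"
  by (rule Cinf_linearD(4)[OF \<pi>_linear(1) one_forms_0])

section \<open>The isomorphism between one-forms and vector fields\<close>

lemma sharp_vfield [simp]: "\<alpha> \<in> \<Omega> \<Longrightarrow> \<sharp> \<alpha> \<in> \<XX>"
  by (rule vfieldI) (auto simp: sharp_def d0_add d0_mult d0_const \<pi>_simps \<pi>_0 d0_outside)

lemma sharp_add: "\<alpha> \<in> \<Omega> \<Longrightarrow> \<beta> \<in> \<Omega> \<Longrightarrow> \<sharp> (\<alpha> + \<beta>) = \<sharp> \<alpha> + \<sharp> \<beta>"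
  and sharp_scale: "f \<in> C \<Longrightarrow> \<alpha> \<in> \<Omega> \<Longrightarrow> \<sharp> (f \<odot> \<alpha>) = f \<odot> \<sharp> \<alpha>"
  by (intro ext; simp add: sharp_def \<pi>_simps)+

lemma \<omega>_sharp: "\<alpha> \<in> \<Omega> \<Longrightarrow> X \<in> \<XX> \<Longrightarrow> w (\<sharp> \<alpha>) X = \<alpha> X"
  using inverse by (simp add: inverse_of_form_def)

lemma \<omega>_nondegenerate:
  assumes "X \<in> \<XX>" "\<And>Y. Y \<in> \<XX> \<Longrightarrow> w X Y = 0"
  shows "X = 0"
proof (rule vfield_eqI)
  fix f assume "f \<in> C"
  then show "X f = 0 f"
    using symplectic assms by (auto simp: symplectic_form_def fun_eq_iff)
qed (use assms in auto)

definition flat :: "'m vfield \<Rightarrow> 'm form" where "flat X = (\<lambda>Y. w X Y)"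

lemma flat_one_form [simp]: "X \<in> \<XX> \<Longrightarrow> flat X \<in> \<Omega>"
  unfolding flat_def by (rule one_formI) (auto simp: \<omega>_linear \<omega>_outside)

lemma flat_sharp: "\<alpha> \<in> \<Omega> \<Longrightarrow> flat (\<sharp> \<alpha>) = \<alpha>"
  by (rule one_form_eqI) (simp_all, simp add: flat_def \<omega>_sharp)

text \<open>By \<open>inverse\<close>, both fields have the same pairing under
  \<open>\<omega>\<close> with every vector field, and nondegeneracy identifies them. With
  \<open>flat_sharp\<close> this makes \<open>\<sharp>\<close> an isomorphism, so every vector field
  may be written as \<open>\<sharp> \<alpha>\<close>.\<close>

lemma sharp_flat:
  assumes "X \<in> \<XX>" shows "\<sharp> (flat X) = X"
proof -
  have "\<sharp> (flat X) - X = 0"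
    using assms by (intro \<omega>_nondegenerate) (auto simp: \<omega>_simps \<omega>_sharp, simp add: flat_def)
  then show ?thesis by simp
qed

lemma sharp_cases:
  assumes "X \<in> \<XX>" obtains \<alpha> where "\<alpha> \<in> \<Omega>" "X = \<sharp> \<alpha>"
  using assms sharp_flat[of X] flat_one_form[of X] by metis

text \<open>Global substitute for ``one-forms are locally combinations of exact ones'': since \<open>\<omega>\<close> is
  nondegenerate, \<open>T \<circ> flat\<close> is a one-form \<open>\<tau>\<close> with \<open>T \<beta> = - \<beta> (\<sharp> \<tau>)\<close>, and vanishing on exact forms
  says that the derivation \<open>\<sharp> \<tau>\<close> is zero.\<close>

lemma Cinf_linear_eq_0:
  assumes T: "Cinf_linear \<Omega> T" and exact: "\<And>f. f \<in> C \<Longrightarrow> T (d0 A f) = 0" and "\<alpha> \<in> \<Omega>"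
  shows "T \<alpha> = 0"
proof -
  define \<tau> where "\<tau> X = (if X \<in> \<XX> then T (flat X) else 0)" for X
  have flat_lin: "flat (X + Y) = flat X + flat Y" "f \<in> C \<Longrightarrow> flat (f \<odot> X) = f \<odot> flat X"
    if "X \<in> \<XX>" "Y \<in> \<XX>" for X Y f
    using that by (auto intro!: one_form_eqI) (simp_all add: flat_def \<omega>_simps)
  have \<tau>: "\<tau> \<in> \<Omega>"
    by (rule one_formI) (auto simp: \<tau>_def Cinf_linear_def flat_lin Cinf_linearD[OF T])
  have *: "T \<beta> = - \<beta> (\<sharp> \<tau>)" if "\<beta> \<in> \<Omega>" for \<beta>
  proof -
    have "T \<beta> = \<tau> (\<sharp> \<beta>)" using that by (simp add: \<tau>_def flat_sharp)
    also have "\<dots> = w (\<sharp> \<tau>) (\<sharp> \<beta>)" using that \<tau> by (simp add: \<omega>_sharp)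
    also have "\<dots> = - \<beta> (\<sharp> \<tau>)" using that \<tau> \<omega>_antisym[of "\<sharp> \<tau>" "\<sharp> \<beta>"] \<omega>_sharp[of \<beta> "\<sharp> \<tau>"] by simp
    finally show ?thesis .
  qed
  have "\<sharp> \<tau> = 0"
    using exact *[OF d0_one_form] \<tau> by (intro vfield_eqI) (auto simp: d0_apply)
  then show ?thesis
    using *[OF \<open>\<alpha> \<in> \<Omega>\<close>] one_form_0[OF \<open>\<alpha> \<in> \<Omega>\<close>] by simp
qed

lemma Cinf_linear_diff:
  "Cinf_linear S T \<Longrightarrow> Cinf_linear S U \<Longrightarrow> Cinf_linear S (\<lambda>x. T x - U x)"
  by (auto simp: Cinf_linear_def algebra_simps)

lemma Cinf_linear_eqI:
  assumes "Cinf_linear \<Omega> T" "Cinf_linear \<Omega> U" "\<And>f. f \<in> C \<Longrightarrow> T (d0 A f) = U (d0 A f)" "\<alpha> \<in> \<Omega>"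
  shows "T \<alpha> = U \<alpha>"
  using Cinf_linear_eq_0[OF Cinf_linear_diff[OF assms(1,2)] _ assms(4)] assms(3) by simp

text \<open>For exact \<open>\<beta>\<close> this is the definition of \<open>\<sharp>\<close>, and
  both sides are \<open>C\<close>-linear in \<open>\<beta>\<close>.\<close>

lemma \<pi>_eq_sharp:
  assumes "\<alpha> \<in> \<Omega>" "\<beta> \<in> \<Omega>" shows "P \<alpha> \<beta> = \<beta> (\<sharp> \<alpha>)"
proof (rule Cinf_linear_eqI[OF \<pi>_linear(1)[OF assms(1)] _ _ assms(2)])
  show "Cinf_linear \<Omega> (\<lambda>\<beta>. \<beta> (\<sharp> \<alpha>))"
    using assms(1) by (simp add: Cinf_linear_def)
  show "P \<alpha> (d0 A f) = d0 A f (\<sharp> \<alpha>)" for f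
    using assms(1) by (simp add: d0_apply) (simp add: sharp_def)
qed

end

section \<open>Flat torsion-free contravariant connections\<close>

locale flat_contravariant = symplectic_poisson A \<pi> \<omega>
  for A :: "('m::{t2_space,second_countable_topology}, 'e::euclidean_space) chart set"
    and \<pi> \<omega> :: "'m tensor" +
  fixes K D :: "'m form \<Rightarrow> 'm form \<Rightarrow> 'm form"
  assumes koszul: "koszul_bracket A \<pi> K"
    and connection: "contravariant_connection A \<pi> D"
    and contravariant_flat: "contravariant_flat A K D"
    and torsion_free: "contravariant_torsion_free A K D"
begin

section \<open>Rules for the Koszul bracket and the connection\<close>

lemma K_closed [simp]: "\<alpha> \<in> \<Omega> \<Longrightarrow> \<beta> \<in> \<Omega> \<Longrightarrow> K \<alpha> \<beta> \<in> \<Omega>"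
  and K_antisym: "\<alpha> \<in> \<Omega> \<Longrightarrow> \<beta> \<in> \<Omega> \<Longrightarrow> K \<alpha> \<beta> = - K \<beta> \<alpha>"
  and K_add: "\<alpha> \<in> \<Omega> \<Longrightarrow> \<beta> \<in> \<Omega> \<Longrightarrow> \<gamma> \<in> \<Omega> \<Longrightarrow> K \<alpha> (\<beta> + \<gamma>) = K \<alpha> \<beta> + K \<alpha> \<gamma>"
  and K_scale: "f \<in> C \<Longrightarrow> \<alpha> \<in> \<Omega> \<Longrightarrow> \<beta> \<in> \<Omega> \<Longrightarrow> K \<alpha> (f \<odot> \<beta>) = f \<odot> K \<alpha> \<beta> + \<sharp> \<alpha> f \<odot> \<beta>"
  and K_exact: "f \<in> C \<Longrightarrow> g \<in> C \<Longrightarrow> K (d0 A f) (d0 A g) = d0 A (poisson_bracket A \<pi> f g)"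
  using koszul unfolding koszul_bracket_def real_bilinear_on_def by meson+

lemma D_closed [simp]: "\<alpha> \<in> \<Omega> \<Longrightarrow> \<beta> \<in> \<Omega> \<Longrightarrow> D \<alpha> \<beta> \<in> \<Omega>"
  and D_add_left: "\<alpha> \<in> \<Omega> \<Longrightarrow> \<beta> \<in> \<Omega> \<Longrightarrow> \<gamma> \<in> \<Omega> \<Longrightarrow> D (\<alpha> + \<beta>) \<gamma> = D \<alpha> \<gamma> + D \<beta> \<gamma>"
  and D_add_right: "\<alpha> \<in> \<Omega> \<Longrightarrow> \<beta> \<in> \<Omega> \<Longrightarrow> \<gamma> \<in> \<Omega> \<Longrightarrow> D \<alpha> (\<beta> + \<gamma>) = D \<alpha> \<beta> + D \<alpha> \<gamma>"
  and D_scale_left: "f \<in> C \<Longrightarrow> \<alpha> \<in> \<Omega> \<Longrightarrow> \<beta> \<in> \<Omega> \<Longrightarrow> D (f \<odot> \<alpha>) \<beta> = f \<odot> D \<alpha> \<beta>"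
  and D_scale_right: "f \<in> C \<Longrightarrow> \<alpha> \<in> \<Omega> \<Longrightarrow> \<beta> \<in> \<Omega> \<Longrightarrow> D \<alpha> (f \<odot> \<beta>) = f \<odot> D \<alpha> \<beta> + \<sharp> \<alpha> f \<odot> \<beta>"
  using connection unfolding contravariant_connection_def real_bilinear_on_def by meson+

lemma D_0: "\<alpha> \<in> \<Omega> \<Longrightarrow> D \<alpha> 0 = 0" "\<alpha> \<in> \<Omega> \<Longrightarrow> D 0 \<alpha> = 0"
  using D_add_right[of \<alpha> 0 0] D_add_left[of 0 0 \<alpha>] by simp_all

lemma D_torsion: "\<alpha> \<in> \<Omega> \<Longrightarrow> \<beta> \<in> \<Omega> \<Longrightarrow> K \<alpha> \<beta> = D \<alpha> \<beta> - D \<beta> \<alpha>"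
  using torsion_free by (simp add: contravariant_torsion_free_def)

text \<open>Flatness with the Koszul bracket eliminated by vanishing torsion, so that only
  \<open>D\<close> occurs; this is what determines the commutator of \<open>dual_D\<close> and
  \<open>endo\<close>.\<close>

lemma D_curvature:
  assumes "\<alpha> \<in> \<Omega>" "\<beta> \<in> \<Omega>" "\<gamma> \<in> \<Omega>"
  shows "D \<alpha> (D \<beta> \<gamma>) - D \<beta> (D \<alpha> \<gamma>) = D (D \<alpha> \<beta>) \<gamma> - D (D \<beta> \<alpha>) \<gamma>"
proof -
  have "D (D \<alpha> \<beta>) \<gamma> = D (K \<alpha> \<beta> + D \<beta> \<alpha>) \<gamma>"
    using assms by (simp add: D_torsion)
  also have "\<dots> = D (K \<alpha> \<beta>) \<gamma> + D (D \<beta> \<alpha>) \<gamma>"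
    using assms by (simp add: D_add_left)
  finally show ?thesis
    using contravariant_flat assms by (simp add: contravariant_flat_def)
qed

section \<open>The anchor is a homomorphism of Lie algebras\<close>

lemma sharp_K_extend:
  assumes "\<alpha> \<in> \<Omega>" and exact: "\<And>h. h \<in> C \<Longrightarrow> \<sharp> (K \<alpha> (d0 A h)) = lie_bracket (\<sharp> \<alpha>) (\<sharp> (d0 A h))"
    and "\<beta> \<in> \<Omega>"
  shows "\<sharp> (K \<alpha> \<beta>) = lie_bracket (\<sharp> \<alpha>) (\<sharp> \<beta>)"
proof (rule vfield_eqI)
  fix f assume f: "f \<in> C"
  \<comment> \<open>Scaling \<open>\<gamma>\<close> by a function \<open>g\<close> produces the same
    extra term, \<open>\<sharp> \<alpha> g\<close> times \<open>\<sharp> \<gamma>\<close>, in both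
    brackets. Their difference is therefore \<open>C\<close>-linear and determined by exact
    forms.\<close>
  define T where "T \<gamma> = \<sharp> (K \<alpha> \<gamma>) f - lie_bracket (\<sharp> \<alpha>) (\<sharp> \<gamma>) f" for \<gamma>
  have "Cinf_linear \<Omega> T"
    unfolding Cinf_linear_def T_def using assms(1) f
    by (auto simp: K_add K_scale sharp_add sharp_scale lie_bracket_def vfield_simps[OF sharp_vfield]
        algebra_simps)
  moreover have "T (d0 A h) = 0" if "h \<in> C" for h
    using exact[OF that] by (simp add: T_def)
  ultimately have "T \<beta> = 0"
    using assms(3) Cinf_linear_eq_0 by blast
  then show "\<sharp> (K \<alpha> \<beta>) f = lie_bracket (\<sharp> \<alpha>) (\<sharp> \<beta>) f"
    by (simp add: T_def)
qed (use assms in auto)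

lemma sharp_uminus: "\<alpha> \<in> \<Omega> \<Longrightarrow> \<sharp> (- \<alpha>) = - \<sharp> \<alpha>"
  using sharp_scale[of "- 1" \<alpha>] by (simp add: scale_minus_one)

text \<open>The Jacobi identity for the Poisson bracket, once \<open>\<sharp> (d0 A u) v\<close> is
  read as the bracket of \<open>u\<close> and \<open>v\<close>.\<close>

lemma sharp_K_exact:
  assumes "g \<in> C" "h \<in> C"
  shows "\<sharp> (K (d0 A g) (d0 A h)) = lie_bracket (\<sharp> (d0 A g)) (\<sharp> (d0 A h))"
proof (rule vfield_eqI)
  fix f assume f: "f \<in> C"
  let ?b = "poisson_bracket A \<pi>"
  have b: "\<sharp> (d0 A u) v = ?b u v" for u v
    by (simp add: sharp_def poisson_bracket_def)
  have antisym: "?b u v = - ?b v u" for u v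
    unfolding poisson_bracket_def by (rule \<pi>_antisym) auto
  have minus: "?b u (- v) = - ?b u v" if "u \<in> C" "v \<in> C" for u v
    using vfield_uminus[of "\<sharp> (d0 A u)" v] that by (simp add: b)
  have closed: "?b u v \<in> C" for u v
    by (simp add: poisson_bracket_def)
  have "?b g (?b h f) + ?b h (?b f g) + ?b f (?b g h) = 0"
    using poisson f assms by (simp add: poisson_bivector_def)
  moreover have "?b h (?b f g) = - ?b h (?b g f)"
    using antisym[of f g] minus[of h "?b g f"] assms closed by simp
  moreover have "?b f (?b g h) = - ?b (?b g h) f"
    by (rule antisym)
  ultimately show "\<sharp> (K (d0 A g) (d0 A h)) f = lie_bracket (\<sharp> (d0 A g)) (\<sharp> (d0 A h)) f"
    using assms by (simp add: K_exact b lie_bracket_def algebra_simps)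
qed auto

text \<open>Two uses of \<open>sharp_K_extend\<close>: from two exact arguments to one, then, with
  the slots exchanged by antisymmetry, to two arbitrary arguments.\<close>

lemma sharp_K:
  assumes "\<alpha> \<in> \<Omega>" "\<beta> \<in> \<Omega>"
  shows "\<sharp> (K \<alpha> \<beta>) = lie_bracket (\<sharp> \<alpha>) (\<sharp> \<beta>)"
proof -
  have "\<sharp> (K \<gamma> (d0 A h)) = lie_bracket (\<sharp> \<gamma>) (\<sharp> (d0 A h))" if "h \<in> C" "\<gamma> \<in> \<Omega>" for h \<gamma>
  proof -
    have "\<sharp> (K (d0 A h) \<gamma>) = lie_bracket (\<sharp> (d0 A h)) (\<sharp> \<gamma>)"
      using that by (intro sharp_K_extend[OF _ sharp_K_exact]) auto
    then show ?thesis
      using that by (subst K_antisym) (auto simp: sharp_uminus lie_bracket_def fun_eq_iff)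
  qed
  then show ?thesis using assms by (auto intro: sharp_K_extend[OF assms(1) _ assms(2)])
qed

section \<open>Action on vector fields and the endomorphisms \<open>endo\<close>\<close>

definition dual_D :: "'m form \<Rightarrow> 'm vfield \<Rightarrow> 'm vfield" where "dual_D = contravariant_vfield A \<pi> D"

text \<open>\<open>endo \<beta>\<close> is the transpose of \<open>\<gamma> \<mapsto> D \<gamma> \<beta>\<close>. Through \<open>\<omega>\<close> it corresponds to the transpose of
  \<open>Z \<mapsto> \<nabla>\<^sub>Z (\<sharp> \<beta>)\<close>, the difference between \<open>\<nabla>\<close> and the Lie derivative along \<open>\<sharp> \<beta>\<close>.\<close>

definition endo :: "'m form \<Rightarrow> 'm vfield \<Rightarrow> 'm vfield" where "endo \<beta> X = (\<lambda>f. D (d0 A f) \<beta> X)"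

lemma dual_D_apply: "dual_D \<alpha> X f = \<sharp> \<alpha> (X f) - D \<alpha> (d0 A f) X"
  by (simp add: dual_D_def contravariant_vfield_def)

lemma dual_D_vfield [simp]:
  assumes "\<alpha> \<in> \<Omega>" "X \<in> \<XX>" shows "dual_D \<alpha> X \<in> \<XX>"
  by (rule vfieldI)
    (use assms in \<open>auto simp: dual_D_apply vfield_simps[of X] vfield_simps[of "\<sharp> \<alpha>"] vfield_outside[of X]
      d0_add d0_mult d0_const d0_outside D_add_right D_scale_right D_0 d0_apply algebra_simps\<close>)

lemma endo_vfield [simp]:
  assumes "\<beta> \<in> \<Omega>" "X \<in> \<XX>" shows "endo \<beta> X \<in> \<XX>"
  by (rule vfieldI)
    (use assms in \<open>auto simp: endo_def d0_add d0_mult d0_const d0_outside D_add_left D_scale_left D_0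
      algebra_simps\<close>)

text \<open>The definition is the case of exact \<open>\<gamma>\<close>. On the right the derivative
  terms created by scaling \<open>\<gamma>\<close> cancel, so both sides are \<open>C\<close>-linear
  in \<open>\<gamma>\<close>.\<close>

lemma form_dual_D:
  assumes "\<alpha> \<in> \<Omega>" "X \<in> \<XX>" "\<gamma> \<in> \<Omega>"
  shows "\<gamma> (dual_D \<alpha> X) = \<sharp> \<alpha> (\<gamma> X) - D \<alpha> \<gamma> X"
proof (rule Cinf_linear_eqI[OF _ _ _ assms(3)])
  show "Cinf_linear \<Omega> (\<lambda>\<gamma>. \<gamma> (dual_D \<alpha> X))"
    using assms by (simp add: Cinf_linear_def)
  show "Cinf_linear \<Omega> (\<lambda>\<gamma>. \<sharp> \<alpha> (\<gamma> X) - D \<alpha> \<gamma> X)"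
    using assms by (auto simp: Cinf_linear_def D_add_right D_scale_right vfield_simps[of "\<sharp> \<alpha>"] algebra_simps)
  show "d0 A f (dual_D \<alpha> X) = \<sharp> \<alpha> (d0 A f X) - D \<alpha> (d0 A f) X" for f
    using assms d0_apply[OF dual_D_vfield] d0_apply[OF assms(2)] by (simp only: dual_D_apply)
qed

lemma form_endo:
  assumes "\<beta> \<in> \<Omega>" "X \<in> \<XX>" "\<gamma> \<in> \<Omega>"
  shows "\<gamma> (endo \<beta> X) = D \<gamma> \<beta> X"
proof (rule Cinf_linear_eqI[OF _ _ _ assms(3)])
  show "Cinf_linear \<Omega> (\<lambda>\<gamma>. \<gamma> (endo \<beta> X))"
    using assms by (simp add: Cinf_linear_def)
  show "Cinf_linear \<Omega> (\<lambda>\<gamma>. D \<gamma> \<beta> X)"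
    using assms by (simp add: Cinf_linear_def D_add_left D_scale_left)
  show "d0 A f (endo \<beta> X) = D (d0 A f) \<beta> X" for f
    using assms by (simp add: d0_apply) (simp add: endo_def)
qed

lemma vfield_form_eqI:
  assumes "X \<in> \<XX>" "Y \<in> \<XX>" "\<And>\<gamma>. \<gamma> \<in> \<Omega> \<Longrightarrow> \<gamma> X = \<gamma> Y"
  shows "X = Y"
proof (rule vfield_eqI[OF assms(1,2)])
  fix f
  have "d0 A f X = d0 A f Y" by (rule assms(3)) simp
  then show "X f = Y f" using assms(1,2) by (simp only: d0_apply)
qed

text \<open>Paired with \<open>\<gamma>\<close>, transposition turns the claim into
  \<open>D_curvature\<close> for \<open>\<alpha>\<close>, \<open>\<gamma>\<close>,
  \<open>\<beta>\<close>; the two terms \<open>\<sharp> \<alpha> (D \<gamma> \<beta> X)\<close> on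
  the left cancel.\<close>

lemma dual_D_endo_commutator:
  assumes "\<alpha> \<in> \<Omega>" "\<beta> \<in> \<Omega>" "X \<in> \<XX>"
  shows "dual_D \<alpha> (endo \<beta> X) - endo \<beta> (dual_D \<alpha> X) = endo (D \<alpha> \<beta>) X - endo \<alpha> (endo \<beta> X)"
proof (rule vfield_form_eqI)
  fix \<gamma> assume \<gamma>: "\<gamma> \<in> \<Omega>"
  have "D \<alpha> (D \<gamma> \<beta>) X - D (D \<alpha> \<gamma>) \<beta> X = D \<gamma> (D \<alpha> \<beta>) X - D (D \<gamma> \<alpha>) \<beta> X"
    using D_curvature[OF assms(1) \<gamma> assms(2), THEN fun_cong, of X] by (simp add: algebra_simps)
  then show "\<gamma> (dual_D \<alpha> (endo \<beta> X) - endo \<beta> (dual_D \<alpha> X)) = \<gamma> (endo (D \<alpha> \<beta>) X - endo \<alpha> (endo \<beta> X))"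
    using assms \<gamma> by (simp add: one_form_diff[of \<gamma>] form_dual_D[of _ _ \<gamma>] form_endo[of _ _ \<gamma>]
        form_dual_D[of _ _ "D \<gamma> \<beta>"] form_endo[of _ _ "D \<alpha> \<gamma>"] form_endo[of _ _ "D \<gamma> \<alpha>"])
qed (use assms in auto)

section \<open>Derivatives of bilinear functions and the exterior derivative of a one-form\<close>

definition D_bilin :: "'m form \<Rightarrow> ('m vfield \<Rightarrow> 'm vfield \<Rightarrow> 'm \<Rightarrow> real) \<Rightarrow> 'm vfield \<Rightarrow> 'm vfield \<Rightarrow> 'm \<Rightarrow> real" where
  "D_bilin \<alpha> S X Y = \<sharp> \<alpha> (S X Y) - S (dual_D \<alpha> X) Y - S X (dual_D \<alpha> Y)"

lemma contravariant_tensor_two: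
  assumes "X \<in> \<XX>" "Y \<in> \<XX>"
  shows "contravariant_tensor A \<pi> D \<alpha> \<sigma> ([], [X, Y]) = D_bilin \<alpha> (\<lambda>X Y. \<sigma> ([], [X, Y])) X Y"
  using assms by (simp add: contravariant_tensor_def leibniz_extension_def D_bilin_def dual_D_def
      numeral_2_eq_2 lessThan_Suc algebra_simps)

text \<open>Cartan's formula: the contraction of \<open>V\<close> with a closed form has the Lie
  derivative along \<open>V\<close> as its differential.\<close>

lemma d1_eq_lie_derivative:
  assumes "V \<in> \<XX>" "X \<in> \<XX>" "Y \<in> \<XX>"
  shows "d1 A (flat V) ([], [X, Y]) = V (w X Y) - w (lie_bracket V X) Y - w X (lie_bracket V Y)"
proof -
  have lie: "lie_bracket Y V = - lie_bracket V Y"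
    by (auto simp: lie_bracket_def fun_eq_iff)
  have "V (w X Y) + X (w Y V) + Y (w V X) - w (lie_bracket V X) Y - w (lie_bracket X Y) V
      - w (lie_bracket Y V) X = 0"
    using symplectic assms by (simp add: symplectic_form_def closed_two_form_def)
  moreover have "X (w Y V) = - X (w V Y)"
    using assms \<omega>_antisym[of Y V] vfield_uminus[of X "w V Y"] by simp
  moreover have "w (lie_bracket X Y) V = - w V (lie_bracket X Y)"
    using assms by (intro \<omega>_antisym) auto
  moreover have "w (lie_bracket Y V) X = w X (lie_bracket V Y)"
    using assms \<omega>_antisym[of "lie_bracket V Y" X] by (simp add: lie \<omega>_simps)
  ultimately show ?thesis
    using assms by (simp add: d1_def flat_def algebra_simps)
qed

text \<open>Since \<open>\<beta> = flat (\<sharp> \<beta>)\<close>, its differential is the Lie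
  derivative of \<open>\<omega>\<close> along \<open>\<sharp> \<beta>\<close>. With \<open>X\<close>
  and \<open>Y\<close> in the image of \<open>\<sharp>\<close>, the Lie brackets become Koszul
  brackets, which vanishing torsion writes through \<open>D\<close>: derivatives of
  \<open>\<beta>\<close> give \<open>endo\<close>, derivatives along \<open>\<beta>\<close> give
  \<open>D_bilin\<close>.\<close>

lemma d1_eq:
  assumes "\<beta> \<in> \<Omega>" "X \<in> \<XX>" "Y \<in> \<XX>"
  shows "d1 A \<beta> ([], [X, Y]) = w (endo \<beta> X) Y + w X (endo \<beta> Y) - D_bilin \<beta> w X Y"
proof -
  obtain \<alpha> where \<alpha>: "\<alpha> \<in> \<Omega>" "X = \<sharp> \<alpha>" using assms sharp_cases by metis
  obtain \<gamma> where \<gamma>: "\<gamma> \<in> \<Omega>" "Y = \<sharp> \<gamma>" using assms sharp_cases by metis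
  have wY: "w Z Y = - \<gamma> Z" if "Z \<in> \<XX>" for Z
    using \<omega>_antisym[OF that, of Y] \<gamma> that by (simp add: \<omega>_sharp)
  have wX: "w X Z = \<alpha> Z" if "Z \<in> \<XX>" for Z
    using \<alpha> that by (simp add: \<omega>_sharp)
  have lX: "lie_bracket (\<sharp> \<beta>) X = \<sharp> (K \<beta> \<alpha>)" and lY: "lie_bracket (\<sharp> \<beta>) Y = \<sharp> (K \<beta> \<gamma>)"
    using \<alpha> \<gamma> assms by (simp_all add: sharp_K)
  \<comment> \<open>Both sides are \<open>w X Y\<close>, read through \<open>X\<close> and through
    \<open>Y\<close>.\<close>
  have XY: "\<alpha> Y = - \<gamma> X" using wY[of X] wX[of Y] assms by simp
  have "d1 A \<beta> ([], [X, Y]) = \<sharp> \<beta> (w X Y) - w (\<sharp> (K \<beta> \<alpha>)) Y - w X (\<sharp> (K \<beta> \<gamma>))"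
    using d1_eq_lie_derivative[of "\<sharp> \<beta>" X Y] assms by (simp add: flat_sharp lX lY)
  also have "w (\<sharp> (K \<beta> \<alpha>)) Y = D \<beta> \<alpha> Y - D \<alpha> \<beta> Y"
    using assms \<alpha> by (subst \<omega>_sharp) (simp_all add: D_torsion[of \<beta> \<alpha>])
  also have "w X (\<sharp> (K \<beta> \<gamma>)) = - w (\<sharp> (K \<beta> \<gamma>)) X"
    using assms \<gamma> by (intro \<omega>_antisym) auto
  also have "w (\<sharp> (K \<beta> \<gamma>)) X = D \<beta> \<gamma> X - D \<gamma> \<beta> X"
    using assms \<gamma> by (subst \<omega>_sharp) (simp_all add: D_torsion[of \<beta> \<gamma>])
  finally have "d1 A \<beta> ([], [X, Y])
      = \<sharp> \<beta> (\<alpha> Y) - (D \<beta> \<alpha> Y - D \<alpha> \<beta> Y) + (D \<beta> \<gamma> X - D \<gamma> \<beta> X)"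
    by (simp only: wX[OF assms(3)] diff_minus_eq_add)
  moreover have "\<sharp> \<beta> (- \<gamma> X) = - \<sharp> \<beta> (\<gamma> X)"
    using assms \<gamma> by (simp add: vfield_uminus[of "\<sharp> \<beta>"])
  ultimately show ?thesis
    using assms \<alpha>(1) \<gamma>(1)
    by (simp add: D_bilin_def wX[of "dual_D \<beta> Y"] wX[of "endo \<beta> Y"] wY[of "dual_D \<beta> X"] wY[of "endo \<beta> X"] wY[of X]
        form_dual_D[of _ _ \<alpha>] form_dual_D[of _ _ \<gamma>] form_endo[of _ _ \<alpha>] form_endo[of _ _ \<gamma>] XY algebra_simps)
qed

definition bilin :: "('m vfield \<Rightarrow> 'm vfield \<Rightarrow> 'm \<Rightarrow> real) \<Rightarrow> bool" where
  "bilin S \<longleftrightarrow> (\<forall>X\<in>\<XX>. Cinf_linear \<XX> (S X)) \<and> (\<forall>Y\<in>\<XX>. Cinf_linear \<XX> (\<lambda>X. S X Y))"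

lemma bilinD:
  assumes "bilin S"
  shows "X \<in> \<XX> \<Longrightarrow> Y \<in> \<XX> \<Longrightarrow> S X Y \<in> C"
    and "X \<in> \<XX> \<Longrightarrow> X' \<in> \<XX> \<Longrightarrow> Y \<in> \<XX> \<Longrightarrow> S (X + X') Y = S X Y + S X' Y"
    and "f \<in> C \<Longrightarrow> X \<in> \<XX> \<Longrightarrow> Y \<in> \<XX> \<Longrightarrow> S (f \<odot> X) Y = f * S X Y"
    and "X \<in> \<XX> \<Longrightarrow> Y \<in> \<XX> \<Longrightarrow> Y' \<in> \<XX> \<Longrightarrow> S X (Y + Y') = S X Y + S X Y'"
    and "f \<in> C \<Longrightarrow> X \<in> \<XX> \<Longrightarrow> Y \<in> \<XX> \<Longrightarrow> S X (f \<odot> Y) = f * S X Y"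
  using assms unfolding bilin_def Cinf_linear_def by meson+

lemma bilinI:
  assumes "\<And>X Y. X \<in> \<XX> \<Longrightarrow> Y \<in> \<XX> \<Longrightarrow> S X Y \<in> C"
    and "\<And>X X' Y. X \<in> \<XX> \<Longrightarrow> X' \<in> \<XX> \<Longrightarrow> Y \<in> \<XX> \<Longrightarrow> S (X + X') Y = S X Y + S X' Y"
    and "\<And>f X Y. f \<in> C \<Longrightarrow> X \<in> \<XX> \<Longrightarrow> Y \<in> \<XX> \<Longrightarrow> S (f \<odot> X) Y = f * S X Y"
    and "\<And>X Y Y'. X \<in> \<XX> \<Longrightarrow> Y \<in> \<XX> \<Longrightarrow> Y' \<in> \<XX> \<Longrightarrow> S X (Y + Y') = S X Y + S X Y'"
    and "\<And>f X Y. f \<in> C \<Longrightarrow> X \<in> \<XX> \<Longrightarrow> Y \<in> \<XX> \<Longrightarrow> S X (f \<odot> Y) = f * S X Y"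
  shows "bilin S"
  unfolding bilin_def Cinf_linear_def using assms by (intro conjI ballI)

lemma bilin_\<omega> [simp]: "bilin (\<lambda>X Y. w X Y)"
  by (simp add: bilin_def \<omega>_linear)

lemma bilin_diff [simp]: "bilin S \<Longrightarrow> bilin T \<Longrightarrow> bilin (\<lambda>X Y. S X Y - T X Y)"
  by (rule bilinI) (auto simp: bilinD[of S] bilinD[of T] algebra_simps)

lemma dual_D_add_right: "\<alpha> \<in> \<Omega> \<Longrightarrow> X \<in> \<XX> \<Longrightarrow> Y \<in> \<XX> \<Longrightarrow> dual_D \<alpha> (X + Y) = dual_D \<alpha> X + dual_D \<alpha> Y"
  and dual_D_scale_right: "\<alpha> \<in> \<Omega> \<Longrightarrow> X \<in> \<XX> \<Longrightarrow> f \<in> C \<Longrightarrow> dual_D \<alpha> (f \<odot> X) = f \<odot> dual_D \<alpha> X + \<sharp> \<alpha> f \<odot> X"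
  and dual_D_add_left: "\<alpha> \<in> \<Omega> \<Longrightarrow> \<beta> \<in> \<Omega> \<Longrightarrow> X \<in> \<XX> \<Longrightarrow> dual_D (\<alpha> + \<beta>) X = dual_D \<alpha> X + dual_D \<beta> X"
  and dual_D_scale_left: "\<alpha> \<in> \<Omega> \<Longrightarrow> X \<in> \<XX> \<Longrightarrow> f \<in> C \<Longrightarrow> dual_D (f \<odot> \<alpha>) X = f \<odot> dual_D \<alpha> X"
  by (rule vfield_eqI;
    simp add: dual_D_apply D_add_left D_scale_left sharp_add sharp_scale vfield_simps[of "\<sharp> \<alpha>"]
      one_form_simps[of "D \<alpha> (d0 A _)"] algebra_simps)+

lemma D_bilin_cong:
  assumes "\<alpha> \<in> \<Omega>" "X \<in> \<XX>" "Y \<in> \<XX>" "\<And>X Y. X \<in> \<XX> \<Longrightarrow> Y \<in> \<XX> \<Longrightarrow> S X Y = T X Y"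
  shows "D_bilin \<alpha> S X Y = D_bilin \<alpha> T X Y"
  unfolding D_bilin_def by (simp only: assms dual_D_vfield)

lemma bilin_D_bilin [simp]:
  assumes "\<alpha> \<in> \<Omega>" "bilin S" shows "bilin (D_bilin \<alpha> S)"
  by (rule bilinI) (use assms in \<open>auto simp: D_bilin_def dual_D_add_right dual_D_scale_right
    bilinD[OF assms(2)] vfield_simps[of "\<sharp> \<alpha>"] algebra_simps\<close>)

lemma D_bilin_add_left:
    "bilin S \<Longrightarrow> \<alpha> \<in> \<Omega> \<Longrightarrow> \<beta> \<in> \<Omega> \<Longrightarrow> X \<in> \<XX> \<Longrightarrow> Y \<in> \<XX> \<Longrightarrow>
      D_bilin (\<alpha> + \<beta>) S X Y = D_bilin \<alpha> S X Y + D_bilin \<beta> S X Y"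
  and D_bilin_scale_left:
    "bilin S \<Longrightarrow> \<alpha> \<in> \<Omega> \<Longrightarrow> f \<in> C \<Longrightarrow> X \<in> \<XX> \<Longrightarrow> Y \<in> \<XX> \<Longrightarrow> D_bilin (f \<odot> \<alpha>) S X Y = f * D_bilin \<alpha> S X Y"
  by (simp_all add: D_bilin_def dual_D_add_left dual_D_scale_left sharp_add sharp_scale bilinD[of S] algebra_simps)

lemma D_bilin_add_right:
    "bilin S \<Longrightarrow> bilin T \<Longrightarrow> \<alpha> \<in> \<Omega> \<Longrightarrow> X \<in> \<XX> \<Longrightarrow> Y \<in> \<XX> \<Longrightarrow>
      D_bilin \<alpha> (\<lambda>X Y. S X Y + T X Y) X Y = D_bilin \<alpha> S X Y + D_bilin \<alpha> T X Y"
  and D_bilin_scale_right: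
    "bilin S \<Longrightarrow> \<alpha> \<in> \<Omega> \<Longrightarrow> f \<in> C \<Longrightarrow> X \<in> \<XX> \<Longrightarrow> Y \<in> \<XX> \<Longrightarrow>
      D_bilin \<alpha> (\<lambda>X Y. f * S X Y) X Y = f * D_bilin \<alpha> S X Y + \<sharp> \<alpha> f * S X Y"
  by (simp_all add: D_bilin_def bilinD[of S] bilinD[of T] vfield_simps[of "\<sharp> \<alpha>"] algebra_simps)

section \<open>Second and third derivatives of the symplectic form\<close>

definition D2 where
  "D2 \<alpha> \<beta> X Y = D_bilin \<alpha> (D_bilin \<beta> (\<lambda>X Y. w X Y)) X Y - D_bilin (D \<alpha> \<beta>) (\<lambda>X Y. w X Y) X Y"

definition D3 where
  "D3 \<alpha> \<beta> \<gamma> X Y = D_bilin \<alpha> (D2 \<beta> \<gamma>) X Y - D2 (D \<alpha> \<beta>) \<gamma> X Y - D2 \<beta> (D \<alpha> \<gamma>) X Y"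

lemma bilin_D2 [simp]: "\<alpha> \<in> \<Omega> \<Longrightarrow> \<beta> \<in> \<Omega> \<Longrightarrow> bilin (D2 \<alpha> \<beta>)"
  unfolding D2_def[abs_def] by simp

lemma bilin_D3 [simp]: "\<alpha> \<in> \<Omega> \<Longrightarrow> \<beta> \<in> \<Omega> \<Longrightarrow> \<gamma> \<in> \<Omega> \<Longrightarrow> bilin (D3 \<alpha> \<beta> \<gamma>)"
  unfolding D3_def[abs_def] by simp

text \<open>The subtracted term along \<open>D \<alpha> \<beta>\<close> makes the second derivative
  tensorial: when \<open>\<beta>\<close> is scaled by \<open>f\<close>, the terms with
  \<open>\<sharp> \<alpha> f\<close> from the two parts cancel.\<close>

lemma D2_linear:
  assumes "\<alpha> \<in> \<Omega>" "\<beta> \<in> \<Omega>" "\<gamma> \<in> \<Omega>" "f \<in> C" "X \<in> \<XX>" "Y \<in> \<XX>"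
  shows "D2 (\<alpha> + \<gamma>) \<beta> X Y = D2 \<alpha> \<beta> X Y + D2 \<gamma> \<beta> X Y"
    and "D2 (f \<odot> \<alpha>) \<beta> X Y = f * D2 \<alpha> \<beta> X Y"
    and "D2 \<alpha> (\<beta> + \<gamma>) X Y = D2 \<alpha> \<beta> X Y + D2 \<alpha> \<gamma> X Y"
    and "D2 \<alpha> (f \<odot> \<beta>) X Y = f * D2 \<alpha> \<beta> X Y"
proof -
  \<comment> \<open>The expansion of the inner derivative holds only on vector fields, so it enters
    under the outer one by congruence.\<close>
  have 1: "D_bilin \<alpha> (D_bilin (\<beta> + \<gamma>) (\<lambda>X Y. w X Y)) X Y
      = D_bilin \<alpha> (\<lambda>X Y. D_bilin \<beta> (\<lambda>X Y. w X Y) X Y + D_bilin \<gamma> (\<lambda>X Y. w X Y) X Y) X Y"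
    using assms by (intro D_bilin_cong) (simp_all add: D_bilin_add_left)
  have 2: "D_bilin \<alpha> (D_bilin (f \<odot> \<beta>) (\<lambda>X Y. w X Y)) X Y
      = D_bilin \<alpha> (\<lambda>X Y. f * D_bilin \<beta> (\<lambda>X Y. w X Y) X Y) X Y"
    using assms by (intro D_bilin_cong) (simp_all add: D_bilin_scale_left)
  show "D2 (\<alpha> + \<gamma>) \<beta> X Y = D2 \<alpha> \<beta> X Y + D2 \<gamma> \<beta> X Y"
    and "D2 (f \<odot> \<alpha>) \<beta> X Y = f * D2 \<alpha> \<beta> X Y"
    and "D2 \<alpha> (\<beta> + \<gamma>) X Y = D2 \<alpha> \<beta> X Y + D2 \<alpha> \<gamma> X Y"
    and "D2 \<alpha> (f \<odot> \<beta>) X Y = f * D2 \<alpha> \<beta> X Y"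
    using assms by (simp_all add: D2_def 1 2 D_bilin_add_left D_bilin_scale_left D_bilin_add_right D_bilin_scale_right
        D_add_left D_add_right D_scale_left D_scale_right algebra_simps)
qed

lemma D3_linear:
  assumes "\<alpha> \<in> \<Omega>" "\<beta> \<in> \<Omega>" "\<gamma> \<in> \<Omega>" "X \<in> \<XX>" "Y \<in> \<XX>"
  shows "Cinf_linear \<Omega> (\<lambda>\<alpha>. D3 \<alpha> \<beta> \<gamma> X Y)"
    and "Cinf_linear \<Omega> (\<lambda>\<beta>. D3 \<alpha> \<beta> \<gamma> X Y)"
    and "Cinf_linear \<Omega> (\<lambda>\<gamma>. D3 \<alpha> \<beta> \<gamma> X Y)"
proof -
  have closed: "D3 \<alpha> \<beta> \<gamma> X Y \<in> C" if "\<alpha> \<in> \<Omega>" "\<beta> \<in> \<Omega>" "\<gamma> \<in> \<Omega>" for \<alpha> \<beta> \<gamma>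
    using bilinD(1)[OF bilin_D3] that assms by blast
  have 1: "D_bilin \<alpha> (D2 (\<beta> + \<beta>') \<gamma>) X Y = D_bilin \<alpha> (\<lambda>X Y. D2 \<beta> \<gamma> X Y + D2 \<beta>' \<gamma> X Y) X Y"
    and 2: "D_bilin \<alpha> (D2 \<beta> (\<gamma> + \<beta>')) X Y = D_bilin \<alpha> (\<lambda>X Y. D2 \<beta> \<gamma> X Y + D2 \<beta> \<beta>' X Y) X Y"
    if "\<beta> \<in> \<Omega>" "\<beta>' \<in> \<Omega>" "\<gamma> \<in> \<Omega>" for \<beta> \<beta>' \<gamma>
    using assms that by (auto intro!: D_bilin_cong simp: D2_linear(1,3)[where f = 0])
  have 3: "D_bilin \<alpha> (D2 (f \<odot> \<beta>) \<gamma>) X Y = D_bilin \<alpha> (\<lambda>X Y. f * D2 \<beta> \<gamma> X Y) X Y"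
    and 4: "D_bilin \<alpha> (D2 \<beta> (f \<odot> \<gamma>)) X Y = D_bilin \<alpha> (\<lambda>X Y. f * D2 \<beta> \<gamma> X Y) X Y"
    if "\<beta> \<in> \<Omega>" "\<gamma> \<in> \<Omega>" "f \<in> C" for \<beta> \<gamma> f
    using assms that by (auto intro!: D_bilin_cong simp: D2_linear(2,4)[where \<gamma> = 0])
  note simps = D2_linear(1,3)[where f = 0] D2_linear(2,4)[where \<gamma> = 0] D_bilin_add_left D_bilin_scale_left
    D_bilin_add_right D_bilin_scale_right D_add_left D_add_right D_scale_left D_scale_right algebra_simps
  show "Cinf_linear \<Omega> (\<lambda>\<alpha>. D3 \<alpha> \<beta> \<gamma> X Y)"
    unfolding Cinf_linear_def using assms
    by (intro conjI ballI closed) (simp_all add: D3_def simps)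
  show "Cinf_linear \<Omega> (\<lambda>\<beta>. D3 \<alpha> \<beta> \<gamma> X Y)"
    unfolding Cinf_linear_def using assms
    by (intro conjI ballI closed) (simp_all add: D3_def 1 3 simps)
  show "Cinf_linear \<Omega> (\<lambda>\<gamma>. D3 \<alpha> \<beta> \<gamma> X Y)"
    unfolding Cinf_linear_def using assms
    by (intro conjI ballI closed) (simp_all add: D3_def 2 4 simps)
qed

text \<open>The transpose of flatness. The second derivatives of the function
  \<open>\<gamma> X\<close> that appear are matched by \<open>sharp_K\<close>.\<close>

lemma dual_D_commute:
  assumes "\<alpha> \<in> \<Omega>" "\<beta> \<in> \<Omega>" "X \<in> \<XX>"
  shows "dual_D \<alpha> (dual_D \<beta> X) = dual_D \<beta> (dual_D \<alpha> X) + dual_D (K \<alpha> \<beta>) X"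
proof (rule vfield_form_eqI)
  fix \<gamma> assume \<gamma>: "\<gamma> \<in> \<Omega>"
  have flat: "D \<alpha> (D \<beta> \<gamma>) X - D \<beta> (D \<alpha> \<gamma>) X - D (K \<alpha> \<beta>) \<gamma> X = 0"
  proof -
    have "D \<alpha> (D \<beta> \<gamma>) - D \<beta> (D \<alpha> \<gamma>) - D (K \<alpha> \<beta>) \<gamma> = 0"
      using contravariant_flat assms \<gamma> by (simp add: contravariant_flat_def)
    from fun_cong[OF this, of X] show ?thesis by simp
  qed
  have K: "\<sharp> (K \<alpha> \<beta>) (\<gamma> X) = \<sharp> \<alpha> (\<sharp> \<beta> (\<gamma> X)) - \<sharp> \<beta> (\<sharp> \<alpha> (\<gamma> X))"
    using assms by (simp add: sharp_K lie_bracket_def)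
  show "\<gamma> (dual_D \<alpha> (dual_D \<beta> X)) = \<gamma> (dual_D \<beta> (dual_D \<alpha> X) + dual_D (K \<alpha> \<beta>) X)"
    using assms \<gamma> flat
    by (simp add: one_form_add[of \<gamma>] form_dual_D[of _ _ \<gamma>] form_dual_D[of _ _ "D \<alpha> \<gamma>"] form_dual_D[of _ _ "D \<beta> \<gamma>"]
        vfield_diff[of "\<sharp> \<alpha>"] vfield_diff[of "\<sharp> \<beta>"] K algebra_simps)
qed (use assms in auto)

text \<open>Ricci identity: the antisymmetric part of a second derivative consists of curvature and
  torsion terms, and both vanish. The symmetry lets an exact form be moved into the first
  slot.\<close>

lemma D2_symmetric:
  assumes "\<alpha> \<in> \<Omega>" "\<beta> \<in> \<Omega>" "X \<in> \<XX>" "Y \<in> \<XX>"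
  shows "D2 \<alpha> \<beta> X Y = D2 \<beta> \<alpha> X Y"
proof -
  let ?w = "\<lambda>X Y. w X Y"
  have "D_bilin (D \<alpha> \<beta>) ?w X Y = D_bilin (K \<alpha> \<beta> + D \<beta> \<alpha>) ?w X Y"
    using assms by (simp add: D_torsion)
  also have "\<dots> = D_bilin (K \<alpha> \<beta>) ?w X Y + D_bilin (D \<beta> \<alpha>) ?w X Y"
    using assms by (simp add: D_bilin_add_left)
  finally have 1: "D_bilin (D \<alpha> \<beta>) ?w X Y = D_bilin (K \<alpha> \<beta>) ?w X Y + D_bilin (D \<beta> \<alpha>) ?w X Y" .
  have "\<sharp> (K \<alpha> \<beta>) (w X Y) = \<sharp> \<alpha> (\<sharp> \<beta> (w X Y)) - \<sharp> \<beta> (\<sharp> \<alpha> (w X Y))"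
    using assms by (simp add: sharp_K lie_bracket_def)
  then have "D_bilin \<alpha> (D_bilin \<beta> ?w) X Y - D_bilin \<beta> (D_bilin \<alpha> ?w) X Y = D_bilin (K \<alpha> \<beta>) ?w X Y"
    using assms by (simp add: D_bilin_def dual_D_commute[of \<alpha> \<beta>] \<omega>_simps
        vfield_add[of "\<sharp> \<alpha>"] vfield_add[of "\<sharp> \<beta>"]
        vfield_diff[of "\<sharp> \<alpha>"] vfield_diff[of "\<sharp> \<beta>"] algebra_simps)
  then show ?thesis
    by (simp add: D2_def 1 algebra_simps)
qed

text \<open>By \<open>d1_eq\<close> this is \<open>d \<beta>\<close>, that is, the Lie derivative of \<open>\<omega>\<close> along \<open>\<sharp> \<beta>\<close>.\<close>

definition lie_\<omega> where
  "lie_\<omega> \<beta> X Y = w (endo \<beta> X) Y + w X (endo \<beta> Y) - D_bilin \<beta> (\<lambda>X Y. w X Y) X Y"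

text \<open>The part of the bracket of \<open>\<alpha>\<close> and \<open>\<beta>\<close> that is
  quadratic in \<open>endo\<close>, up to sign.\<close>

definition cross where
  "cross \<alpha> \<beta> X Y = w (endo \<alpha> X) (endo \<beta> Y) + w (endo \<beta> X) (endo \<alpha> Y)"

section \<open>Differentiation along exact one-forms\<close>

lemma lie_\<omega>_exact:
  assumes "f \<in> C" "X \<in> \<XX>" "Y \<in> \<XX>"
  shows "lie_\<omega> (d0 A f) X Y = 0"
proof -
  \<comment> \<open>This is \<open>d d f = 0\<close>; geometrically, Hamiltonian fields preserve
    \<open>\<omega>\<close>.\<close>
  have "d1 A (d0 A f) ([], [X, Y]) = 0"
    using assms by (simp add: d1_def d0_apply) (simp add: lie_bracket_def)
  then show ?thesis
    using assms by (simp add: d1_eq lie_\<omega>_def)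
qed

text \<open>The identity \<open>D\<^sub>\<alpha> \<omega> = a\<^sub>\<alpha> \<cdot>
  \<omega>\<close> for exact \<open>\<alpha>\<close>, solved for the derivative of the function
  \<open>w X Y\<close> so that it can serve as a rewrite rule.\<close>

lemma D_bilin_\<omega>_exact:
  assumes "f \<in> C" "X \<in> \<XX>" "Y \<in> \<XX>"
  shows "\<sharp> (d0 A f) (w X Y) = w (endo (d0 A f) X) Y + w X (endo (d0 A f) Y)
     + w (dual_D (d0 A f) X) Y + w X (dual_D (d0 A f) Y)"
  using lie_\<omega>_exact[OF assms] by (simp add: lie_\<omega>_def D_bilin_def algebra_simps)

lemma dual_D_endo_commute: 
  assumes "\<alpha> \<in> \<Omega>" "\<beta> \<in> \<Omega>" "X \<in> \<XX>"
  shows "dual_D \<alpha> (endo \<beta> X) = endo \<beta> (dual_D \<alpha> X) + (endo (D \<alpha> \<beta>) X - endo \<alpha> (endo \<beta> X))"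
  using dual_D_endo_commutator[OF assms] by (simp add: algebra_simps)

text \<open>In the derivative of \<open>a\<^sub>\<beta> \<cdot> \<omega>\<close>, the compositions
  \<open>a\<^sub>\<alpha> a\<^sub>\<beta>\<close> from \<open>D\<^sub>\<alpha> \<omega>\<close> and
  from the commutator cancel, while the mixed terms form \<open>cross\<close>. The derivative of
  \<open>D\<^sub>\<beta> \<omega>\<close> splits into \<open>D2\<close> and the derivative along
  \<open>D\<^sub>\<alpha> \<beta>\<close>.\<close>

lemma D_bilin_lie_\<omega>:
  assumes f: "f \<in> C" and "\<beta> \<in> \<Omega>" "X \<in> \<XX>" "Y \<in> \<XX>"
  shows "D_bilin (d0 A f) (lie_\<omega> \<beta>) X Y = lie_\<omega> (D (d0 A f) \<beta>) X Y + cross (d0 A f) \<beta> X Y - D2 (d0 A f) \<beta> X Y"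
proof -
  \<comment> \<open>The inner derivative is kept as a bilinear function with smooth values while the
    outer one, along \<open>d0 A f\<close>, is expanded.\<close>
  define S where "S = D_bilin \<beta> (\<lambda>X Y. w X Y)"
  have S: "bilin S" using assms by (simp add: S_def)
  show ?thesis
    using assms
    by (simp add: lie_\<omega>_def[abs_def] cross_def D2_def D_bilin_def[of "d0 A f"] vfield_add[of "\<sharp> (d0 A f)"]
        vfield_diff[of "\<sharp> (d0 A f)"] D_bilin_\<omega>_exact dual_D_endo_commute \<omega>_simps bilinD(1)[OF S] algebra_simps flip: S_def)
qed

text \<open>The terms from \<open>D\<^sub>\<alpha> \<omega> = a\<^sub>\<alpha> \<cdot>
  \<omega>\<close> cancel the compositions with \<open>a\<^sub>\<alpha>\<close> in the commutators,
  so only the derivatives of \<open>\<beta>\<close> and \<open>\<gamma>\<close> remain.\<close>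

lemma D_bilin_cross:
  assumes "f \<in> C" "\<beta> \<in> \<Omega>" "\<gamma> \<in> \<Omega>" "X \<in> \<XX>" "Y \<in> \<XX>"
  shows "D_bilin (d0 A f) (cross \<beta> \<gamma>) X Y = cross (D (d0 A f) \<beta>) \<gamma> X Y + cross \<beta> (D (d0 A f) \<gamma>) X Y"
  using assms by (simp add: D_bilin_def cross_def vfield_add[of "\<sharp> (d0 A f)"] D_bilin_\<omega>_exact dual_D_endo_commute \<omega>_simps algebra_simps)

lemma cross_commute: "cross \<alpha> \<beta> = cross \<beta> \<alpha>"
  by (intro ext) (simp add: cross_def add.commute)

section \<open>Evaluation of the iterated \<open>contravariant_derivative\<close>\<close>

lemma contravariant_derivative_outside:
  assumes T: "\<And>\<alpha>s Xs. \<not> (length \<alpha>s = p \<and> length Xs = q \<and> set \<alpha>s \<subseteq> \<Omega> \<and> set Xs \<subseteq> \<XX>) \<Longrightarrow> T (\<alpha>s, Xs) = 0"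
    and "\<not> (length \<alpha>s = Suc p \<and> length Xs = q \<and> set \<alpha>s \<subseteq> \<Omega> \<and> set Xs \<subseteq> \<XX>)"
  shows "contravariant_derivative A \<pi> D T (\<alpha>s, Xs) = 0"
proof (cases \<alpha>s)
  case Nil
  then show ?thesis by (simp add: contravariant_derivative_def)
next
  case (Cons \<alpha> \<gamma>s)
  show ?thesis
  proof (cases "\<alpha> \<in> \<Omega> \<and> set \<gamma>s \<subseteq> \<Omega> \<and> set Xs \<subseteq> \<XX>")
    case True
    then have "length \<gamma>s \<noteq> p \<or> length Xs \<noteq> q"
      using assms(2) Cons by auto
    \<comment> \<open>The Leibniz formula only replaces entries of the lists, so a wrong length
      persists in each of its terms.\<close>
    then have T0: "T (\<beta>s, Ys) = 0" if "length \<beta>s = length \<gamma>s" "length Ys = length Xs" for \<beta>s Ys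
      by (intro T) (use that in auto)
    show ?thesis
      using Cons True vfield_0[OF sharp_vfield, of \<alpha>]
      by (simp add: contravariant_derivative_def contravariant_tensor_def leibniz_extension_def T0)
  next
    case False
    then show ?thesis
      using Cons
      by (auto simp: contravariant_derivative_def contravariant_tensor_def leibniz_extension_def)
  qed
qed

lemma contravariant_derivative_\<omega>:
  assumes "\<alpha> \<in> \<Omega>" "X \<in> \<XX>" "Y \<in> \<XX>"
  shows "contravariant_derivative A \<pi> D \<omega> ([\<alpha>], [X, Y]) = D_bilin \<alpha> (\<lambda>X Y. w X Y) X Y"
  using assms by (simp add: contravariant_derivative_def contravariant_tensor_two)

lemma contravariant_derivative2_\<omega>:
  assumes "\<alpha> \<in> \<Omega>" "\<beta> \<in> \<Omega>" "X \<in> \<XX>" "Y \<in> \<XX>"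
  shows "contravariant_derivative A \<pi> D (contravariant_derivative A \<pi> D \<omega>) ([\<alpha>, \<beta>], [X, Y]) = D2 \<alpha> \<beta> X Y"
  \<comment> \<open>Only the outer derivative is unfolded; the inner one is then evaluated by the
    preceding lemma.\<close>
  using assms unfolding contravariant_derivative_def[of _ _ _ "contravariant_derivative A \<pi> D \<omega>"]
  by (simp add: contravariant_tensor_def leibniz_extension_def dual_D_def[symmetric]
      contravariant_derivative_\<omega> D2_def D_bilin_def[of \<alpha>] numeral_2_eq_2 lessThan_Suc algebra_simps)

lemma contravariant_derivative3_\<omega>:
  assumes "\<alpha> \<in> \<Omega>" "\<beta> \<in> \<Omega>" "\<gamma> \<in> \<Omega>" "X \<in> \<XX>" "Y \<in> \<XX>"
  shows "contravariant_derivative A \<pi> D (contravariant_derivative A \<pi> D (contravariant_derivative A \<pi> D \<omega>))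
     ([\<alpha>, \<beta>, \<gamma>], [X, Y]) = D3 \<alpha> \<beta> \<gamma> X Y"
  using assms unfolding contravariant_derivative_def[of _ _ _ "contravariant_derivative A \<pi> D (contravariant_derivative A \<pi> D \<omega>)"]
  by (simp add: contravariant_tensor_def leibniz_extension_def dual_D_def[symmetric]
      contravariant_derivative2_\<omega> D3_def D_bilin_def[of \<alpha>] numeral_2_eq_2 lessThan_Suc algebra_simps)

end

section \<open>Metacurvature\<close>

locale metacurved = flat_contravariant A \<pi> \<omega> K D
  for A :: "('m::{t2_space,second_countable_topology}, 'e::euclidean_space) chart set"
    and \<pi> \<omega> :: "'m tensor" and K D :: "'m form \<Rightarrow> 'm form \<Rightarrow> 'm form" +
  fixes B :: "'m form \<Rightarrow> 'm form \<Rightarrow> 'm tensor" and M :: "'m tensor"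
  assumes bracket: "metacurvature_bracket A \<pi> D B"
    and metacurvature: "metacurvature A \<pi> D B M"
begin

section \<open>Bracket and metacurvature on exact forms\<close>

lemma B_commute: "\<alpha> \<in> \<Omega> \<Longrightarrow> \<beta> \<in> \<Omega> \<Longrightarrow> B \<alpha> \<beta> = B \<beta> \<alpha>"
  using bracket unfolding metacurvature_bracket_def by blast

text \<open>The axiom for \<open>d {f, \<beta>}\<close> determines the bracket with
  \<open>df\<close>. Both exterior derivatives in it are instances of \<open>lie_\<omega>\<close>,
  and after \<open>D_bilin_lie_\<omega>\<close> the terms
  \<open>lie_\<omega> (D (d0 A f) \<beta>)\<close> cancel.\<close>

lemma B_exact:
  assumes "f \<in> C" "\<beta> \<in> \<Omega>" "X \<in> \<XX>" "Y \<in> \<XX>"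
  shows "B (d0 A f) \<beta> ([], [X, Y]) = D2 (d0 A f) \<beta> X Y - cross (d0 A f) \<beta> X Y"
proof -
  have d1_lie_\<omega>: "d1 A \<gamma> ([], [X, Y]) = lie_\<omega> \<gamma> X Y" if "\<gamma> \<in> \<Omega>" "X \<in> \<XX>" "Y \<in> \<XX>" for \<gamma> X Y
    using that by (simp add: d1_eq lie_\<omega>_def)
  have "d1 A (D (d0 A f) \<beta>) = B (d0 A f) \<beta> + contravariant_tensor A \<pi> D (d0 A f) (d1 A \<beta>)"
    using bracket assms by (simp add: metacurvature_bracket_def)
  from fun_cong[OF this, of "([], [X, Y])"]
  have "lie_\<omega> (D (d0 A f) \<beta>) X Y = B (d0 A f) \<beta> ([], [X, Y]) + D_bilin (d0 A f) (\<lambda>X Y. d1 A \<beta> ([], [X, Y])) X Y"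
    using assms by (simp add: d1_lie_\<omega> contravariant_tensor_two)
  also have "D_bilin (d0 A f) (\<lambda>X Y. d1 A \<beta> ([], [X, Y])) X Y = D_bilin (d0 A f) (lie_\<omega> \<beta>) X Y"
    using assms by (intro D_bilin_cong) (simp_all add: d1_lie_\<omega>)
  finally have *: "lie_\<omega> (D (d0 A f) \<beta>) X Y = B (d0 A f) \<beta> ([], [X, Y])
      + (lie_\<omega> (D (d0 A f) \<beta>) X Y + cross (d0 A f) \<beta> X Y - D2 (d0 A f) \<beta> X Y)"
    unfolding D_bilin_lie_\<omega>[OF assms] .
  show ?thesis
  proof
    fix p
    show "B (d0 A f) \<beta> ([], [X, Y]) p = (D2 (d0 A f) \<beta> X Y - cross (d0 A f) \<beta> X Y) p"
      using fun_cong[OF *, of p] unfolding plus_fun_apply minus_apply by linarith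
  qed
qed

text \<open>By \<open>D_bilin_cross\<close> the derivative of \<open>cross\<close> is the sum of the
  two \<open>cross\<close> terms in the remaining brackets, with opposite total sign. What is left
  is the Leibniz formula for \<open>D3\<close>.\<close>

lemma M_exact:
  assumes "f \<in> C" "g \<in> C" "h \<in> C" "X \<in> \<XX>" "Y \<in> \<XX>"
  shows "M ([d0 A f, d0 A g, d0 A h], [X, Y]) = D3 (d0 A f) (d0 A g) (d0 A h) X Y"
proof -
  let ?F = "d0 A f" and ?G = "d0 A g" and ?H = "d0 A h"
  have cross_closed: "cross ?G ?H X Y \<in> C" for X Y
    by (simp add: cross_def)
  have 1: "D_bilin ?F (\<lambda>X Y. B ?G ?H ([], [X, Y])) X Y = D_bilin ?F (\<lambda>X Y. D2 ?G ?H X Y - cross ?G ?H X Y) X Y"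
    using assms by (intro D_bilin_cong) (simp_all add: B_exact)
  also have "\<dots> = D_bilin ?F (D2 ?G ?H) X Y - D_bilin ?F (cross ?G ?H) X Y"
    using assms cross_closed bilinD(1)[OF bilin_D2[of ?G ?H]]
    by (simp add: D_bilin_def vfield_diff[of "\<sharp> ?F"])
  finally have *: "D_bilin ?F (\<lambda>X Y. B ?G ?H ([], [X, Y])) X Y = D_bilin ?F (D2 ?G ?H) X Y - D_bilin ?F (cross ?G ?H) X Y" .
  have "M ([?F, ?G, ?H], [X, Y]) = contravariant_tensor A \<pi> D ?F (B ?G ?H) ([], [X, Y])
      - B (D ?F ?G) ?H ([], [X, Y]) - B (D ?F ?H) ?G ([], [X, Y])"
    by (rule metacurvature[unfolded metacurvature_def, THEN conjunct2, THEN conjunct2, rule_format])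
      (use assms in auto)
  \<comment> \<open>The arguments of the last two brackets are exchanged to put an exact form first,
    as \<open>B_exact\<close> requires.\<close>
  also have "\<dots> = D_bilin ?F (D2 ?G ?H) X Y - D_bilin ?F (cross ?G ?H) X Y
      - B ?H (D ?F ?G) ([], [X, Y]) - B ?G (D ?F ?H) ([], [X, Y])"
    using assms by (simp add: contravariant_tensor_two * B_commute[of "D ?F ?G"] B_commute[of "D ?F ?H"])
  also have "\<dots> = D3 ?F ?G ?H X Y"
    using assms by (simp add: B_exact D_bilin_cross D3_def D2_symmetric[of ?H "D ?F ?G"]
        cross_commute[of ?H "D ?F ?G"] algebra_simps)
  finally show ?thesis .
qed

section \<open>From exact to arbitrary one-forms\<close>

lemma M_tensor: "is_tensor A 3 2 M"
  using metacurvature by (simp add: metacurvature_def)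

lemma M_linear:
  assumes "\<alpha> \<in> \<Omega>" "\<beta> \<in> \<Omega>" "\<gamma> \<in> \<Omega>" "X \<in> \<XX>" "Y \<in> \<XX>"
  shows "Cinf_linear \<Omega> (\<lambda>\<alpha>. M ([\<alpha>, \<beta>, \<gamma>], [X, Y]))"
    and "Cinf_linear \<Omega> (\<lambda>\<beta>. M ([\<alpha>, \<beta>, \<gamma>], [X, Y]))"
    and "Cinf_linear \<Omega> (\<lambda>\<gamma>. M ([\<alpha>, \<beta>, \<gamma>], [X, Y]))"
  unfolding Cinf_linear_def
  using tensor_closed[OF M_tensor] assms
    tensor_upper(1)[OF M_tensor, of "[\<alpha>, \<beta>, \<gamma>]" "[X, Y]" 0 _ _ 0]
    tensor_upper(2)[OF M_tensor, of "[\<alpha>, \<beta>, \<gamma>]" "[X, Y]" 0 _ 0]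
    tensor_upper(1)[OF M_tensor, of "[\<alpha>, \<beta>, \<gamma>]" "[X, Y]" 1 _ _ 0]
    tensor_upper(2)[OF M_tensor, of "[\<alpha>, \<beta>, \<gamma>]" "[X, Y]" 1 _ 0]
    tensor_upper(1)[OF M_tensor, of "[\<alpha>, \<beta>, \<gamma>]" "[X, Y]" 2 _ _ 0]
    tensor_upper(2)[OF M_tensor, of "[\<alpha>, \<beta>, \<gamma>]" "[X, Y]" 2 _ 0]
  by (simp_all add: numeral_2_eq_2)

text \<open>Both sides are \<open>C\<close>-linear in each slot, so agreement on exact triples
  spreads one slot at a time, from the third to the first.\<close>

lemma M_eq_D3:
  assumes "\<alpha> \<in> \<Omega>" "\<beta> \<in> \<Omega>" "\<gamma> \<in> \<Omega>" and XY: "X \<in> \<XX>" "Y \<in> \<XX>"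
  shows "M ([\<alpha>, \<beta>, \<gamma>], [X, Y]) = D3 \<alpha> \<beta> \<gamma> X Y"
proof -
  have 1: "M ([d0 A f, d0 A g, \<gamma>], [X, Y]) = D3 (d0 A f) (d0 A g) \<gamma> X Y" if "f \<in> C" "g \<in> C" "\<gamma> \<in> \<Omega>" for f g \<gamma>
    by (rule Cinf_linear_eqI[OF M_linear(3) D3_linear(3) _ that(3)]) (use that XY in \<open>simp_all add: M_exact\<close>)
  have 2: "M ([d0 A f, \<beta>, \<gamma>], [X, Y]) = D3 (d0 A f) \<beta> \<gamma> X Y" if "f \<in> C" "\<beta> \<in> \<Omega>" "\<gamma> \<in> \<Omega>" for f \<beta> \<gamma>
    by (rule Cinf_linear_eqI[OF M_linear(2) D3_linear(2) _ that(2)]) (use that XY in \<open>simp_all add: 1\<close>)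
  show ?thesis
    by (rule Cinf_linear_eqI[OF M_linear(1) D3_linear(1) _ assms(1)]) (use assms in \<open>simp_all add: 2\<close>)
qed

lemma M_eq_contravariant_derivative:
  "M = contravariant_derivative A \<pi> D (contravariant_derivative A \<pi> D (contravariant_derivative A \<pi> D \<omega>))"
    (is "M = ?R")
proof (rule ext, clarify)
  fix \<alpha>s :: "'m form list" and Xs :: "'m vfield list"
  show "M (\<alpha>s, Xs) = ?R (\<alpha>s, Xs)"
  proof (cases "length \<alpha>s = 3 \<and> length Xs = 2 \<and> set \<alpha>s \<subseteq> \<Omega> \<and> set Xs \<subseteq> \<XX>")
    case True
    then obtain \<alpha> \<beta> \<gamma> X Y where "\<alpha>s = [\<alpha>, \<beta>, \<gamma>]" "Xs = [X, Y]"
      by (auto simp: numeral_2_eq_2 numeral_3_eq_3 length_Suc_conv)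
    then show ?thesis
      using True by (simp add: M_eq_D3 contravariant_derivative3_\<omega>)
  next
    case False
    have "?R (\<alpha>s, Xs) = 0"
      \<comment> \<open>Equality of total functions also needs vanishing off the domain. Each
        derivative adds one upper index, from none for \<open>\<omega>\<close> to three.\<close>
      by (rule contravariant_derivative_outside[where p = 2 and q = 2],
          rule contravariant_derivative_outside[where p = 1 and q = 2],
          rule contravariant_derivative_outside[where p = 0 and q = 2],
          rule tensor_outside[OF \<omega>_tensor]) (use False in auto)
    then show ?thesis
      using tensor_outside[OF M_tensor False] by simp
  qed
qed

text \<open>Contravariant differentiation puts its new index first, covariant differentiation puts
  it last; this symmetry reconciles the two orders.\<close>

lemma M_reverse:
  assumes "\<alpha> \<in> \<Omega>" "\<beta> \<in> \<Omega>" "\<gamma> \<in> \<Omega>" "X \<in> \<XX>" "Y \<in> \<XX>"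
  shows "M ([\<alpha>, \<beta>, \<gamma>], [X, Y]) = M ([\<gamma>, \<beta>, \<alpha>], [X, Y])"
proof -
  have sym: "M ([\<alpha>, \<beta>, \<gamma>], [X, Y]) = M ([\<beta>, \<alpha>, \<gamma>], [X, Y])" "M ([\<alpha>, \<beta>, \<gamma>], [X, Y]) = M ([\<alpha>, \<gamma>, \<beta>], [X, Y])"
    if "\<alpha> \<in> \<Omega>" "\<beta> \<in> \<Omega>" "\<gamma> \<in> \<Omega>" for \<alpha> \<beta> \<gamma>
    using metacurvature that assms(4,5) unfolding metacurvature_def by blast+
  show ?thesis
    using sym(1)[OF assms(1,2,3)] sym(2)[OF assms(2,1,3)] sym(1)[OF assms(2,3,1)] by simp
qed

end

section \<open>The covariant connection\<close>

locale sharp_related_connection = flat_contravariant A \<pi> \<omega> K D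
  for A :: "('m::{t2_space,second_countable_topology}, 'e::euclidean_space) chart set"
    and \<pi> \<omega> :: "'m tensor" and K D :: "'m form \<Rightarrow> 'm form \<Rightarrow> 'm form" +
  fixes N :: "'m vfield \<Rightarrow> 'm vfield \<Rightarrow> 'm vfield"
  assumes covariant: "covariant_connection A N"
    and sharp_D: "\<And>\<alpha> \<beta>. \<alpha> \<in> \<Omega> \<Longrightarrow> \<beta> \<in> \<Omega> \<Longrightarrow> \<sharp> (D \<alpha> \<beta>) = N (\<sharp> \<alpha>) (\<sharp> \<beta>)"
begin

section \<open>Flatness and vanishing torsion of the covariant connection\<close>

lemma N_closed [simp]: "X \<in> \<XX> \<Longrightarrow> Y \<in> \<XX> \<Longrightarrow> N X Y \<in> \<XX>"
  using covariant by (simp add: covariant_connection_def)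

lemma sharp_diff: "\<alpha> \<in> \<Omega> \<Longrightarrow> \<beta> \<in> \<Omega> \<Longrightarrow> \<sharp> (\<alpha> - \<beta>) = \<sharp> \<alpha> - \<sharp> \<beta>"
  using sharp_add[of \<alpha> "- \<beta>"] sharp_uminus[of \<beta>] by simp

lemma sharp_0: "\<sharp> 0 = 0"
  using sharp_add[of 0 0] by simp

text \<open>The isomorphism \<open>\<sharp>\<close> carries \<open>D\<close> to \<open>N\<close> and
  \<open>K\<close> to the Lie bracket, so the torsion of \<open>N\<close> is the image of that of
  \<open>D\<close>. \<open>N_flat\<close> treats curvature in the same way.\<close>

lemma N_torsion_free: "covariant_torsion_free A N"
  unfolding covariant_torsion_free_def
proof (intro ballI)
  fix X Y assume "X \<in> \<XX>" "Y \<in> \<XX>"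
  then obtain \<alpha> \<beta> where *: "\<alpha> \<in> \<Omega>" "X = \<sharp> \<alpha>" "\<beta> \<in> \<Omega>" "Y = \<sharp> \<beta>"
    using sharp_cases by metis
  then have "N X Y - N Y X = \<sharp> (K \<alpha> \<beta>)"
    by (simp add: sharp_diff D_torsion sharp_D)
  then show "N X Y - N Y X = lie_bracket X Y"
    using * by (simp add: sharp_K)
qed

lemma N_flat: "covariant_flat A N"
  unfolding covariant_flat_def
proof (intro ballI)
  fix X Y Z assume "X \<in> \<XX>" "Y \<in> \<XX>" "Z \<in> \<XX>"
  then obtain \<alpha> \<beta> \<gamma> where *: "\<alpha> \<in> \<Omega>" "X = \<sharp> \<alpha>" "\<beta> \<in> \<Omega>" "Y = \<sharp> \<beta>" "\<gamma> \<in> \<Omega>" "Z = \<sharp> \<gamma>"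
    using sharp_cases by metis
  have "N X (N Y Z) - N Y (N X Z) - N (lie_bracket X Y) Z
      = \<sharp> (D \<alpha> (D \<beta> \<gamma>) - D \<beta> (D \<alpha> \<gamma>) - D (K \<alpha> \<beta>) \<gamma>)"
    using * by (simp add: sharp_diff sharp_D flip: sharp_K)
  then show "N X (N Y Z) - N Y (N X Z) - N (lie_bracket X Y) Z = 0"
    using contravariant_flat * by (simp add: contravariant_flat_def sharp_0)
qed

section \<open>Lowering of indices and derivatives of the bivector\<close>

definition coflat :: "'m vfield \<Rightarrow> 'm form" where "coflat X = (\<lambda>Z. w Z X)"

lemma coflat_one_form [simp]: "X \<in> \<XX> \<Longrightarrow> coflat X \<in> \<Omega>"
  unfolding coflat_def by (rule one_formI) (auto simp: \<omega>_linear \<omega>_outside)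

lemma coflat_sharp: "\<alpha> \<in> \<Omega> \<Longrightarrow> X \<in> \<XX> \<Longrightarrow> coflat X (\<sharp> \<alpha>) = \<alpha> X"
  by (simp add: coflat_def \<omega>_sharp)

text \<open>Source of the minus sign in the formula with \<open>\<pi>\<close>. The form
  \<open>coflat X\<close> has components \<open>\<omega>\<^sub>d\<^sub>l X\<^sup>l\<close>, and
  pairing two such forms by \<open>\<pi>\<close> gives \<open>w Y X\<close>.\<close>

lemma \<pi>_coflat:
  assumes "X \<in> \<XX>" "Y \<in> \<XX>" shows "P (coflat X) (coflat Y) = - w X Y"
proof -
  have "P (coflat X) (coflat Y) = coflat X Y"
    using assms by (simp add: \<pi>_eq_sharp coflat_sharp)
  then show ?thesis
    using \<omega>_antisym[of Y X] assms by (simp add: coflat_def)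
qed

text \<open>At \<open>Z = \<sharp> \<beta>\<close> the left side becomes
  \<open>\<sharp> \<alpha> (\<beta> X) - D \<alpha> \<beta> X\<close>, because \<open>N\<close> is
  the image of \<open>D\<close>; this is \<open>form_dual_D\<close>.\<close>

lemma covariant_form_coflat:
  assumes "\<alpha> \<in> \<Omega>" "X \<in> \<XX>"
  shows "covariant_form A N (\<sharp> \<alpha>) (coflat X) = coflat (dual_D \<alpha> X)"
proof
  fix Z
  show "covariant_form A N (\<sharp> \<alpha>) (coflat X) Z = coflat (dual_D \<alpha> X) Z"
  proof (cases "Z \<in> \<XX>")
    case True
    then obtain \<beta> where \<beta>: "\<beta> \<in> \<Omega>" "Z = \<sharp> \<beta>" using sharp_cases by metis
    have "covariant_form A N (\<sharp> \<alpha>) (coflat X) Z = \<sharp> \<alpha> (coflat X Z) - coflat X (N (\<sharp> \<alpha>) Z)"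
      using True by (simp add: covariant_form_def)
    also have "coflat X Z = \<beta> X"
      using \<beta> assms by (simp add: coflat_sharp)
    also have "coflat X (N (\<sharp> \<alpha>) Z) = D \<alpha> \<beta> X"
      using \<beta> assms by (simp add: coflat_sharp flip: sharp_D)
    also have "\<sharp> \<alpha> (\<beta> X) - D \<alpha> \<beta> X = \<beta> (dual_D \<alpha> X)"
      by (rule form_dual_D[OF assms \<beta>(1), symmetric])
    also have "\<beta> (dual_D \<alpha> X) = coflat (dual_D \<alpha> X) Z"
      using \<beta> assms by (simp add: coflat_sharp)
    finally show ?thesis .
  next
    case False
    then show ?thesis by (simp add: covariant_form_def coflat_def \<omega>_outside)
  qed
qed

lemma covariant_derivative_\<pi>:
  assumes "\<alpha> \<in> \<Omega>" "X \<in> \<XX>" "Y \<in> \<XX>"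
  shows "covariant_derivative A N \<pi> ([coflat X, coflat Y], [\<sharp> \<alpha>]) = - D_bilin \<alpha> (\<lambda>X Y. w X Y) X Y"
  using assms by (simp add: covariant_derivative_def covariant_tensor_def leibniz_extension_def
      covariant_form_coflat \<pi>_coflat D_bilin_def vfield_uminus[of "\<sharp> \<alpha>"] numeral_2_eq_2 lessThan_Suc algebra_simps)

text \<open>The vector fields stand in reverse order because \<open>covariant_derivative\<close>
  appends its index, while \<open>\<alpha>\<close> is the outermost direction in
  \<open>D2 \<alpha> \<beta>\<close>. The correction by
  \<open>N (\<sharp> \<alpha>) (\<sharp> \<beta>)\<close> becomes the one by
  \<open>D \<alpha> \<beta>\<close>.\<close>

lemma covariant_derivative2_\<pi>:
  assumes "\<alpha> \<in> \<Omega>" "\<beta> \<in> \<Omega>" "X \<in> \<XX>" "Y \<in> \<XX>"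
  shows "covariant_derivative A N (covariant_derivative A N \<pi>) ([coflat X, coflat Y], [\<sharp> \<beta>, \<sharp> \<alpha>]) = - D2 \<alpha> \<beta> X Y"
  using assms bilinD(1)[OF bilin_D_bilin[OF assms(2) bilin_\<omega>]]
  unfolding covariant_derivative_def[of _ _ "covariant_derivative A N \<pi>"]
  by (simp add: covariant_tensor_def leibniz_extension_def covariant_form_coflat
      covariant_derivative_\<pi> D2_def D_bilin_def[of \<alpha>] vfield_uminus[of "\<sharp> \<alpha>"] numeral_2_eq_2 lessThan_Suc
      algebra_simps flip: sharp_D)

lemma covariant_derivative3_\<pi>:
  assumes "\<alpha> \<in> \<Omega>" "\<beta> \<in> \<Omega>" "\<gamma> \<in> \<Omega>" "X \<in> \<XX>" "Y \<in> \<XX>"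
  shows "covariant_derivative A N (covariant_derivative A N (covariant_derivative A N \<pi>))
    ([coflat X, coflat Y], [\<sharp> \<gamma>, \<sharp> \<beta>, \<sharp> \<alpha>]) = - D3 \<alpha> \<beta> \<gamma> X Y"
  using assms bilinD(1)[OF bilin_D2[OF assms(2,3)]]
  unfolding covariant_derivative_def[of _ _ "covariant_derivative A N (covariant_derivative A N \<pi>)"]
  by (simp add: covariant_tensor_def leibniz_extension_def covariant_form_coflat
      covariant_derivative2_\<pi> D3_def D_bilin_def[of \<alpha>] vfield_uminus[of "\<sharp> \<alpha>"] numeral_2_eq_2 lessThan_Suc
      algebra_simps flip: sharp_D)

end

text \<open>The second formula is contracted with arbitrary arguments:
  \<open>\<pi>\<^sup>i\<^sup>a \<alpha>\<^sub>i\<close> is \<open>\<sharp> \<alpha>\<close>, and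
  \<open>\<omega>\<^sub>d\<^sub>l X\<^sup>l\<close> is the form sending \<open>Z\<close> to
  \<open>\<omega> ([], [Z, X])\<close>.\<close>

theorem theorem2p4:
  fixes A :: "('m::{t2_space,second_countable_topology}, 'e::euclidean_space) chart set"
    and \<pi> \<omega> M :: "'m tensor"
    and K D :: "'m form \<Rightarrow> 'm form \<Rightarrow> 'm form"
    and B :: "'m form \<Rightarrow> 'm form \<Rightarrow> 'm tensor"
    and N :: "'m vfield \<Rightarrow> 'm vfield \<Rightarrow> 'm vfield"
  assumes "smooth_atlas A"
    and "poisson_bivector A \<pi>"
    and "symplectic_form A \<omega>"
    and "inverse_of_form A \<pi> \<omega>"
    and "koszul_bracket A \<pi> K"
    and "contravariant_connection A \<pi> D"
    and "contravariant_flat A K D"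
    and "contravariant_torsion_free A K D"
    and "metacurvature_bracket A \<pi> D B"
    and "metacurvature A \<pi> D B M"
    and "covariant_connection A N"
    and "\<And>\<alpha> \<beta>. \<alpha> \<in> one_forms A \<Longrightarrow> \<beta> \<in> one_forms A \<Longrightarrow>
           sharp A \<pi> (D \<alpha> \<beta>) = N (sharp A \<pi> \<alpha>) (sharp A \<pi> \<beta>)"
  shows "covariant_flat A N \<and> covariant_torsion_free A N \<and>
    M = contravariant_derivative A \<pi> D
          (contravariant_derivative A \<pi> D (contravariant_derivative A \<pi> D \<omega>)) \<and>
    (\<forall>\<alpha>\<in>one_forms A. \<forall>\<beta>\<in>one_forms A. \<forall>\<gamma>\<in>one_forms A. \<forall>X\<in>vfields A. \<forall>Y\<in>vfields A.
       M ([\<alpha>, \<beta>, \<gamma>], [X, Y]) =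
         - covariant_derivative A N (covariant_derivative A N (covariant_derivative A N \<pi>))
             ([\<lambda>Z. \<omega> ([], [Z, X]), \<lambda>Z. \<omega> ([], [Z, Y])],
              [sharp A \<pi> \<alpha>, sharp A \<pi> \<beta>, sharp A \<pi> \<gamma>]))"
proof -
  interpret metacurved A \<pi> \<omega> K D B M
    by unfold_locales (fact assms)+
  interpret sharp_related_connection A \<pi> \<omega> K D N
    by unfold_locales (fact assms)+
  have "M ([\<alpha>, \<beta>, \<gamma>], [X, Y]) =
      - covariant_derivative A N (covariant_derivative A N (covariant_derivative A N \<pi>))
          ([coflat X, coflat Y], [\<sharp> \<alpha>, \<sharp> \<beta>, \<sharp> \<gamma>])"
    if "\<alpha> \<in> \<Omega>" "\<beta> \<in> \<Omega>" "\<gamma> \<in> \<Omega>" "X \<in> \<XX>" "Y \<in> \<XX>" for \<alpha> \<beta> \<gamma> X Y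
    \<comment> \<open>The covariant side evaluates to \<open>D3 \<gamma> \<beta> \<alpha>\<close>,
      so \<open>M\<close> is reversed first.\<close>
    using that M_reverse[of \<alpha> \<beta> \<gamma> X Y]
    by (simp add: M_eq_D3[of \<gamma> \<beta> \<alpha>] covariant_derivative3_\<pi>)
  then show ?thesis
    using N_flat N_torsion_free M_eq_contravariant_derivative by (simp add: coflat_def)
qed

end
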